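(* Let $\Gamma$ be a simple connected cubic girth-regular graph of girth $g$ and order $n$ with signature $(2,2,2)$. Then $g$ divides $3n$ and $\Gamma$ is the skeleton of a $\{g,3\}$-map embedded on a surface with Euler characteristic $\chi=n\left(\frac{3}{g}-\frac12\right)$. Moreover, every automorphism of $\Gamma$ extends to an automorphism of this map; in particular, if $\Gamma$ is vertex-transitive, so is the map.
   Context: Cubic means $3$-regular. For a graph of finite girth $g$, a girth cycle is a cycle of length $g$, and $\epsilon(e)$ is the number of girth cycles containing the edge $e$. The signature of a vertex $v$ with incident edges $e_1,\ldots,e_k$ ordered so that $\epsilon(e_1)\le\cdots\le\epsilon(e_k)$ is $(\epsilon(e_1),\ldots,\epsilon(e_k))$; a graph is girth-regular if all vertices have the same signature (the signature of the graph). A map: view a connected graph $\Lambda$ as a $1$-dimensional CW complex and, for a set $\mathcal{T}$ of simple closed walks (closed walks using each edge at most once), attach one disk per walk along the closed curve of the walk (injectively except over vertices); if the result is a closed surface it is a map with skeleton $\Lambda$, faces the $2$-cells and face cycles the walks of $\mathcal{T}$. A $\{m,k\}$-map is one whose skeleton is $k$-regular and all of whose face cycles have length $m$. An automorphism of a map is a permutation of flags induced by a homeomorphism of the surface preserving the embedded graph; a map is vertex-transitive if its automorphism group induces a vertex-transitive group on its skeleton. *)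

theory Defs
  imports "HOL-Analysis.Analysis" "HOL-Library.Extended_Nat" "HOL-Library.Multiset"
begin

definition simple_graph :: "'a set \<Rightarrow> 'a set set \<Rightarrow> bool" where
  "simple_graph V E \<longleftrightarrow> finite V \<and> (\<forall>e\<in>E. e \<subseteq> V \<and> card e = 2)"

definition connected_graph :: "'a set \<Rightarrow> 'a set set \<Rightarrow> bool" where
  "connected_graph V E \<longleftrightarrow> V \<noteq> {} \<and> (\<forall>u\<in>V. \<forall>v\<in>V. (u, v) \<in> {(x, y). {x, y} \<in> E}\<^sup>*)"

definition incident_edges :: "'a set set \<Rightarrow> 'a \<Rightarrow> 'a set set" where
  "incident_edges E v = {e \<in> E. v \<in> e}"

definition regular_graph :: "'a set \<Rightarrow> 'a set set \<Rightarrow> nat \<Rightarrow> bool" where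
  "regular_graph V E k \<longleftrightarrow> (\<forall>v\<in>V. card (incident_edges E v) = k)"

definition graph_automorphism :: "'a set \<Rightarrow> 'a set set \<Rightarrow> ('a \<Rightarrow> 'a) \<Rightarrow> bool" where
  "graph_automorphism V E \<alpha> \<longleftrightarrow>
     bij_betw \<alpha> V V \<and> (\<forall>u\<in>V. \<forall>v\<in>V. {\<alpha> u, \<alpha> v} \<in> E \<longleftrightarrow> {u, v} \<in> E)"

definition vertex_transitive_graph :: "'a set \<Rightarrow> 'a set set \<Rightarrow> bool" where
  "vertex_transitive_graph V E \<longleftrightarrow> (\<forall>u\<in>V. \<forall>v\<in>V. \<exists>\<alpha>. graph_automorphism V E \<alpha> \<and> \<alpha> u = v)"


text \<open>A closed walk of length \<open>m\<close> is the list of its \<open>m\<close> successive vertices; the start vertex is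
  not repeated at the end, so the last edge joins the last entry to the first one.\<close>

definition walk_edges :: "'a list \<Rightarrow> 'a set list" where
  "walk_edges w = map (\<lambda>i. {w ! i, w ! (Suc i mod length w)}) [0..<length w]"

definition closed_walk :: "'a set set \<Rightarrow> 'a list \<Rightarrow> bool" where
  "closed_walk E w \<longleftrightarrow> w \<noteq> [] \<and> set (walk_edges w) \<subseteq> E"

definition simple_closed_walk :: "'a set set \<Rightarrow> 'a list \<Rightarrow> bool" where
  "simple_closed_walk E w \<longleftrightarrow> closed_walk E w \<and> distinct (walk_edges w)"

definition cycle_walk :: "'a set set \<Rightarrow> 'a list \<Rightarrow> bool" where
  "cycle_walk E w \<longleftrightarrow> closed_walk E w \<and> distinct w \<and> length w \<ge> 3"

definition girth :: "'a set set \<Rightarrow> enat" where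
  "girth E = (INF w\<in>{w. cycle_walk E w}. enat (length w))"

text \<open>Cycles are counted as subgraphs, i.e. by their edge sets, and not as rooted oriented walks.\<close>

definition girth_cycles :: "'a set set \<Rightarrow> 'a set set set" where
  "girth_cycles E = {set (walk_edges w) |w. cycle_walk E w \<and> enat (length w) = girth E}"

definition edge_girth_count :: "'a set set \<Rightarrow> 'a set \<Rightarrow> nat" where
  "edge_girth_count E e = card {C \<in> girth_cycles E. e \<in> C}"

definition vertex_signature :: "'a set set \<Rightarrow> 'a \<Rightarrow> nat list" where
  "vertex_signature E v =
     sorted_list_of_multiset (image_mset (edge_girth_count E) (mset_set (incident_edges E v)))"

definition girth_regular :: "'a set \<Rightarrow> 'a set set \<Rightarrow> bool" where
  "girth_regular V E \<longleftrightarrow> (\<forall>u\<in>V. \<forall>v\<in>V. vertex_signature E u = vertex_signature E v)"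

definition has_signature :: "'a set \<Rightarrow> 'a set set \<Rightarrow> nat list \<Rightarrow> bool" where
  "has_signature V E s \<longleftrightarrow> girth_regular V E \<and> (\<forall>v\<in>V. vertex_signature E v = s)"


text \<open>The finite simple graph as a 1-dimensional CW complex, in barycentric coordinates: vertex \<open>v\<close>
  is the indicator function of \<open>v\<close>, the edge \<open>{u, v}\<close> is the segment joining the two indicator
  functions, and the topology is inherited from the product topology on functions.\<close>

definition vertex_point :: "'a \<Rightarrow> 'a \<Rightarrow> real" where
  "vertex_point v = (\<lambda>x. if x = v then 1 else 0)"

definition edge_point :: "'a \<Rightarrow> 'a \<Rightarrow> real \<Rightarrow> 'a \<Rightarrow> real" where
  "edge_point u v t = (\<lambda>x. (1 - t) * vertex_point u x + t * vertex_point v x)"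

definition graph_realization :: "'a set \<Rightarrow> 'a set set \<Rightarrow> ('a \<Rightarrow> real) set" where
  "graph_realization V E =
     vertex_point ` V \<union> {edge_point u v t |u v t. {u, v} \<in> E \<and> 0 \<le> t \<and> t \<le> 1}"

text \<open>The closed curve of a walk of length \<open>m\<close>, parametrised by the unit circle: the point
  \<open>exp (2 \<pi> \<i> (i + s) / m)\<close> with \<open>i < m\<close> and \<open>0 \<le> s < 1\<close> is sent to the point at parameter \<open>s\<close>
  of the \<open>i\<close>-th step.  If no edge is repeated, this is injective except over vertices.\<close>

definition walk_curve :: "'a list \<Rightarrow> complex \<Rightarrow> 'a \<Rightarrow> real" where
  "walk_curve w z =
     (let t = real (length w) * Arg2pi z / (2 * pi); i = nat \<lfloor>t\<rfloor>
      in edge_point (w ! i) (w ! (Suc i mod length w)) (frac t))"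

text \<open>Attaching one closed unit disk per walk in \<open>T\<close>: after the identification of boundary points,
  the points are those of the graph together with \<open>(w, z)\<close> for \<open>w \<in> T\<close> and \<open>z\<close> in the open disk.
  The topology is the quotient topology, i.e. a set is open iff its preimages in the graph
  and in every closed disk are open.\<close>

type_synonym 'a map_point = "('a \<Rightarrow> real) + ('a list \<times> complex)"

definition map_points :: "'a set \<Rightarrow> 'a set set \<Rightarrow> 'a list set \<Rightarrow> 'a map_point set" where
  "map_points V E T = Inl ` graph_realization V E \<union> Inr ` (T \<times> ball 0 1)"

definition disk_map :: "'a list \<Rightarrow> complex \<Rightarrow> 'a map_point" where
  "disk_map w z = (if norm z < 1 then Inr (w, z) else Inl (walk_curve w z))"

definition map_open :: "'a set \<Rightarrow> 'a set set \<Rightarrow> 'a list set \<Rightarrow> 'a map_point set \<Rightarrow> bool" where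
  "map_open V E T U \<longleftrightarrow> U \<subseteq> map_points V E T \<and>
     openin (top_of_set (graph_realization V E)) {x \<in> graph_realization V E. Inl x \<in> U} \<and>
     (\<forall>w\<in>T. openin (top_of_set (cball 0 1)) {z \<in> cball 0 1. disk_map w z \<in> U})"

definition map_space :: "'a set \<Rightarrow> 'a set set \<Rightarrow> 'a list set \<Rightarrow> 'a map_point topology" where
  "map_space V E T = topology (map_open V E T)"

lemma istopology_map_open: "istopology (map_open V E T)"
  unfolding istopology_def
proof (intro conjI allI impI)
  fix S U assume S: "map_open V E T S" and U: "map_open V E T U"
  have 1: "{x \<in> graph_realization V E. Inl x \<in> S \<inter> U} =
      {x \<in> graph_realization V E. Inl x \<in> S} \<inter> {x \<in> graph_realization V E. Inl x \<in> U}"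
    and 2: "\<And>w. {z \<in> cball 0 1. disk_map w z \<in> S \<inter> U} =
      {z \<in> cball 0 1. disk_map w z \<in> S} \<inter> {z \<in> cball 0 1. disk_map w z \<in> U}"
    by auto
  show "map_open V E T (S \<inter> U)"
    using S U unfolding map_open_def 1 2 by (intro conjI ballI openin_Int) auto
next
  fix K assume K: "\<forall>U\<in>K. map_open V E T U"
  have 1: "{x \<in> graph_realization V E. Inl x \<in> \<Union> K} =
      (\<Union>U\<in>K. {x \<in> graph_realization V E. Inl x \<in> U})"
    and 2: "\<And>w. {z \<in> cball 0 1. disk_map w z \<in> \<Union> K} = (\<Union>U\<in>K. {z \<in> cball 0 1. disk_map w z \<in> U})"
    by auto
  show "map_open V E T (\<Union> K)"
    using K unfolding map_open_def 1 2 by (intro conjI ballI openin_Union) auto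
qed

lemma openin_map_space: "openin (map_space V E T) U \<longleftrightarrow> map_open V E T U"
  by (simp add: map_space_def istopology_map_open topology_inverse')

lemma walk_curve_in_graph_realization:
  assumes "closed_walk E w"
  shows "walk_curve w z \<in> graph_realization V E"
proof -
  define t where "t = real (length w) * Arg2pi z / (2 * pi)"
  define i where "i = nat \<lfloor>t\<rfloor>"
  have w: "length w > 0" and E: "set (walk_edges w) \<subseteq> E"
    using assms by (auto simp: closed_walk_def)
  have t0: "0 \<le> t" using Arg2pi_ge_0 by (simp add: t_def)
  have "t < real (length w)"
    using Arg2pi_lt_2pi[of z] w by (simp add: t_def divide_less_eq)
  then have "i < length w" using t0 by (simp add: i_def nat_less_iff floor_less_iff)
  then have "{w ! i, w ! (Suc i mod length w)} \<in> E"
    using E by (auto simp: walk_edges_def)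
  moreover have "0 \<le> frac t" "frac t \<le> 1"
    using frac_lt_1[of t] by simp_all
  ultimately show ?thesis
    unfolding walk_curve_def graph_realization_def Let_def t_def[symmetric] i_def[symmetric]
    by blast
qed

lemma topspace_map_space:
  assumes "\<And>w. w \<in> T \<Longrightarrow> closed_walk E w"
  shows "topspace (map_space V E T) = map_points V E T"
proof
  show "topspace (map_space V E T) \<subseteq> map_points V E T"
    using openin_topspace[of "map_space V E T"] unfolding openin_map_space map_open_def by blast
  have 1: "{x \<in> graph_realization V E. Inl x \<in> map_points V E T} = graph_realization V E"
    by (auto simp: map_points_def)
  have 2: "{z \<in> cball 0 1. disk_map w z \<in> map_points V E T} = cball 0 1" if "w \<in> T" for w
    using that walk_curve_in_graph_realization[OF assms[OF that]]
    by (auto simp: map_points_def disk_map_def)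
  have "openin (map_space V E T) (map_points V E T)"
    unfolding openin_map_space map_open_def 1
  proof (intro conjI ballI)
    fix w assume "w \<in> T"
    show "openin (top_of_set (cball 0 1)) {z \<in> cball 0 1. disk_map w z \<in> map_points V E T}"
      unfolding 2[OF \<open>w \<in> T\<close>] by (rule openin_subtopology_self)
  qed simp_all
  then show "map_points V E T \<subseteq> topspace (map_space V E T)"
    by (rule openin_subset)
qed

text \<open>Second countability is omitted: it follows from compactness and the charts.\<close>

definition closed_surface :: "'b topology \<Rightarrow> bool" where
  "closed_surface X \<longleftrightarrow> compact_space X \<and> connected_space X \<and> Hausdorff_space X \<and>
     (\<forall>x\<in>topspace X. \<exists>U. openin X U \<and> x \<in> U \<and>
        (\<exists>W :: complex set. open W \<and> subtopology X U homeomorphic_space top_of_set W))"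

definition is_map :: "'a set \<Rightarrow> 'a set set \<Rightarrow> 'a list set \<Rightarrow> bool" where
  "is_map V E T \<longleftrightarrow> simple_graph V E \<and> connected_graph V E \<and>
     (\<forall>w\<in>T. simple_closed_walk E w) \<and> closed_surface (map_space V E T)"

definition mk_map :: "nat \<Rightarrow> nat \<Rightarrow> 'a set \<Rightarrow> 'a set set \<Rightarrow> 'a list set \<Rightarrow> bool" where
  "mk_map m k V E T \<longleftrightarrow> is_map V E T \<and> regular_graph V E k \<and> (\<forall>w\<in>T. length w = m)"

text \<open>The Euler characteristic of the surface, computed from its cell structure.\<close>

definition euler_char :: "'a set \<Rightarrow> 'a set set \<Rightarrow> 'a list set \<Rightarrow> int" where
  "euler_char V E T = int (card V) - int (card E) + int (card T)"


definition open_edge :: "'a set \<Rightarrow> 'a map_point set" where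
  "open_edge e = {Inl (edge_point u v t) |u v t. {u, v} = e \<and> 0 < t \<and> t < 1}"

definition open_face :: "'a list \<Rightarrow> 'a map_point set" where
  "open_face w = {Inr (w, z) |z. norm z < 1}"

text \<open>As the skeleton is simple and a face cycle uses an edge at most once, a flag is
  determined by its vertex, edge and face.\<close>

definition flags :: "'a set set \<Rightarrow> 'a list set \<Rightarrow> ('a \<times> 'a set \<times> 'a list) set" where
  "flags E T = {(v, e, w). e \<in> E \<and> w \<in> T \<and> v \<in> e \<and> e \<in> set (walk_edges w)}"

definition preserves_graph ::
  "'a set \<Rightarrow> 'a set set \<Rightarrow> ('a map_point \<Rightarrow> 'a map_point) \<Rightarrow> bool" where
  "preserves_graph V E h \<longleftrightarrow>
     h ` (Inl ` vertex_point ` V) = Inl ` vertex_point ` V \<and>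
     h ` (Inl ` graph_realization V E) = Inl ` graph_realization V E"

definition map_automorphism ::
  "'a set \<Rightarrow> 'a set set \<Rightarrow> 'a list set \<Rightarrow>
    ('a \<times> 'a set \<times> 'a list \<Rightarrow> 'a \<times> 'a set \<times> 'a list) \<Rightarrow> bool" where
  "map_automorphism V E T \<phi> \<longleftrightarrow> bij_betw \<phi> (flags E T) (flags E T) \<and>
     (\<exists>h. homeomorphic_map (map_space V E T) (map_space V E T) h \<and> preserves_graph V E h \<and>
        (\<forall>(v, e, w) \<in> flags E T. \<forall>v' e' w'. \<phi> (v, e, w) = (v', e', w') \<longrightarrow>
           h (Inl (vertex_point v)) = Inl (vertex_point v') \<and>
           h ` open_edge e = open_edge e' \<and>
           h ` open_face w = open_face w'))"

text \<open>The permutation of flags \<open>\<phi>\<close> acts on the vertices and edges of the skeleton as \<open>\<alpha>\<close>.\<close>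

definition flag_map_extends ::
  "'a set set \<Rightarrow> 'a list set \<Rightarrow>
    ('a \<times> 'a set \<times> 'a list \<Rightarrow> 'a \<times> 'a set \<times> 'a list) \<Rightarrow> ('a \<Rightarrow> 'a) \<Rightarrow> bool" where
  "flag_map_extends E T \<phi> \<alpha> \<longleftrightarrow>
     (\<forall>(v, e, w) \<in> flags E T. \<exists>w'. \<phi> (v, e, w) = (\<alpha> v, \<alpha> ` e, w'))"

definition vertex_transitive_map :: "'a set \<Rightarrow> 'a set set \<Rightarrow> 'a list set \<Rightarrow> bool" where
  "vertex_transitive_map V E T \<longleftrightarrow>
     (\<forall>u\<in>V. \<forall>v\<in>V. \<exists>\<phi> \<alpha>. map_automorphism V E T \<phi> \<and> graph_automorphism V E \<alpha> \<and>
        flag_map_extends E T \<phi> \<alpha> \<and> \<alpha> u = v)"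

end

theory Submission
  imports Defs
begin

text \<open>Let \<open>v\<close> be a vertex with incident edges \<open>e\<^sub>1, e\<^sub>2, e\<^sub>3\<close>. A girth cycle through \<open>v\<close> uses exactly
  two of them, and each edge lies on two girth cycles, so the numbers \<open>n\<^sub>i\<^sub>j\<close> of girth cycles through
  \<open>e\<^sub>i\<close> and \<open>e\<^sub>j\<close> satisfy \<open>n\<^sub>1\<^sub>2 + n\<^sub>1\<^sub>3 = n\<^sub>1\<^sub>2 + n\<^sub>2\<^sub>3 = n\<^sub>1\<^sub>3 + n\<^sub>2\<^sub>3 = 2\<close>: every corner lies on exactly one
  girth cycle. Hence gluing a disk to every girth cycle closes up around the vertices and yields a
  surface; counting incidences gives \<open>2 |E| = 3 n\<close> and \<open>2 |E| = g |T|\<close>.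

  The quotient space is handled through an embedding. Each disk is the cone over its boundary
  cycle, so the barycentric coordinates of the graph, together with one height coordinate per face,
  map the compact quotient space injectively and continuously into a product of real lines. On the
  image, charts around the vertices are piecewise linear, and an automorphism of the graph, which
  permutes the girth cycles, acts by permuting coordinates.\<close>

section \<open>Cyclic indexing of closed walks\<close>

text \<open>Integer indices modulo the length let predecessors and successors be written
  \<open>k - 1\<close> and \<open>k + 1\<close>, with no case distinction where the walk closes
  up.\<close>

definition cyc :: "'a list \<Rightarrow> int \<Rightarrow> 'a" where
  "cyc w k = w ! nat (k mod int (length w))"

lemma cyc_in_set: "w \<noteq> [] \<Longrightarrow> cyc w k \<in> set w"
  by (auto simp: cyc_def nat_less_iff intro!: nth_mem)

lemma cyc_eq_iff:
  assumes "w \<noteq> []" "distinct w"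
  shows "cyc w i = cyc w j \<longleftrightarrow> i mod int (length w) = j mod int (length w)"
proof -
  have *: "nat (k mod int (length w)) < length w" for k
    using assms by (simp add: nat_less_iff)
  have "0 \<le> i mod int (length w)" "0 \<le> j mod int (length w)" using assms by auto
  then show ?thesis
    unfolding cyc_def nth_eq_iff_index_eq[OF assms(2) * *] by (metis nat_0_le)
qed

lemma cyc_eq_imp_dvd:
  assumes "w \<noteq> []" "distinct w" "cyc w i = cyc w j"
  shows "int (length w) dvd i - j"
  using assms by (simp add: cyc_eq_iff mod_eq_dvd_iff)

lemma set_eq_range_cyc:
  assumes "w \<noteq> []"
  shows "set w = range (cyc w)"
proof
  show "range (cyc w) \<subseteq> set w" using cyc_in_set[OF assms] by auto
  show "set w \<subseteq> range (cyc w)"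
  proof
    fix v assume "v \<in> set w"
    then obtain i where "i < length w" "v = w ! i" by (auto simp: in_set_conv_nth)
    then have "v = cyc w (int i)" by (simp add: cyc_def)
    then show "v \<in> range (cyc w)" by blast
  qed
qed

lemma walk_edge_cyc:
  assumes "i < length w"
  shows "{w ! i, w ! (Suc i mod length w)} = {cyc w (int i), cyc w (int i + 1)}"
proof -
  have "nat ((int i + 1) mod int (length w)) = Suc i mod length w"
    by (metis add.commute nat_int of_nat_Suc zmod_int)
  then show ?thesis using assms by (simp add: cyc_def)
qed

lemma set_walk_edges:
  assumes "w \<noteq> []"
  shows "set (walk_edges w) = range (\<lambda>k. {cyc w k, cyc w (k + 1)})"
proof
  show "set (walk_edges w) \<subseteq> range (\<lambda>k. {cyc w k, cyc w (k + 1)})"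
    unfolding walk_edges_def using walk_edge_cyc by fastforce
  show "range (\<lambda>k. {cyc w k, cyc w (k + 1)}) \<subseteq> set (walk_edges w)"
  proof safe
    fix k
    define i where "i = nat (k mod int (length w))"
    have i: "i < length w" "int i = k mod int (length w)"
      using assms by (auto simp: i_def nat_less_iff)
    have "cyc w k = cyc w (int i)" "cyc w (k + 1) = cyc w (int i + 1)"
      unfolding cyc_def i by (simp_all add: mod_simps)
    then have "{cyc w k, cyc w (k + 1)} = {w ! i, w ! (Suc i mod length w)}"
      using walk_edge_cyc[OF i(1)] by simp
    then show "{cyc w k, cyc w (k + 1)} \<in> set (walk_edges w)"
      using i(1) by (auto simp: walk_edges_def)
  qed
qed

locale cycle =
  fixes w :: "'a list"
  assumes distinct_w: "distinct w" and length_w: "3 \<le> length w"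
begin

lemma w_nonempty: "w \<noteq> []"
  using length_w by auto

lemma cyc_eq_small:
  assumes "cyc w i = cyc w j" "\<bar>i - j\<bar> < int (length w)"
  shows "i = j"
  using cyc_eq_imp_dvd[OF w_nonempty distinct_w assms(1)] assms(2)
    dvd_imp_le_int[of "i - j" "int (length w)"] by force

text \<open>An edge of the walk at \<open>cyc w k\<close> can match step \<open>l\<close> in two
  orientations, so \<open>k\<close> is congruent to \<open>l\<close> or to \<open>l + 1\<close>;
  shifting the congruence by one identifies the other end.\<close>

lemma neighbour_iff:
  "{cyc w k, y} \<in> set (walk_edges w) \<longleftrightarrow> y = cyc w (k + 1) \<or> y = cyc w (k - 1)"
proof
  assume "{cyc w k, y} \<in> set (walk_edges w)"
  then obtain l where l: "{cyc w k, y} = {cyc w l, cyc w (l + 1)}"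
    by (auto simp: set_walk_edges[OF w_nonempty])
  have shift: "cyc w (i + d) = cyc w (j + d)" if "cyc w i = cyc w j" for i j d
    using that unfolding cyc_eq_iff[OF w_nonempty distinct_w] by (rule mod_add_cong) simp
  from l consider "cyc w k = cyc w l" "y = cyc w (l + 1)" | "cyc w k = cyc w (l + 1)" "y = cyc w l"
    by (auto simp: doubleton_eq_iff)
  then show "y = cyc w (k + 1) \<or> y = cyc w (k - 1)"
  proof cases
    case 1
    then show ?thesis using shift[of k l 1] by simp
  next
    case 2
    then show ?thesis using shift[of k "l + 1" "-1"] by simp
  qed
next
  assume "y = cyc w (k + 1) \<or> y = cyc w (k - 1)"
  then show "{cyc w k, y} \<in> set (walk_edges w)"
  proof
    assume "y = cyc w (k - 1)"
    then have "{cyc w k, y} = {cyc w (k - 1), cyc w (k - 1 + 1)}" by auto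
    then show ?thesis unfolding set_walk_edges[OF w_nonempty] by blast
  qed (auto simp: set_walk_edges[OF w_nonempty])
qed

lemma next_neq: "cyc w (k + 1) \<noteq> cyc w k" "cyc w (k - 1) \<noteq> cyc w k" "cyc w (k + 1) \<noteq> cyc w (k - 1)"
  using cyc_eq_small[of "k + 1" k] cyc_eq_small[of "k - 1" k] cyc_eq_small[of "k + 1" "k - 1"] length_w
  by auto

lemma edge_subset: "e \<in> set (walk_edges w) \<Longrightarrow> e \<subseteq> set w"
  using cyc_in_set[OF w_nonempty] by (auto simp: set_walk_edges[OF w_nonempty])

text \<open>This is the local fact behind the corner count: a cycle enters and leaves each of its
  vertices once, through two different neighbours.\<close>

lemma two_edges_at_vertex:
  assumes "{v, a} \<in> set (walk_edges w)"
  obtains b where "b \<noteq> a" "{y. {v, y} \<in> set (walk_edges w)} = {a, b}"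
proof -
  have "v \<in> set w" using edge_subset[OF assms] by simp
  then obtain k where k: "v = cyc w k" using set_eq_range_cyc[OF w_nonempty] by auto
  have *: "{y. {v, y} \<in> set (walk_edges w)} = {cyc w (k + 1), cyc w (k - 1)}"
    unfolding k neighbour_iff by blast
  with assms have "a = cyc w (k + 1) \<or> a = cyc w (k - 1)" by blast
  then show thesis
    using that[of "cyc w (k + 1)"] that[of "cyc w (k - 1)"] * next_neq(3)[of k] by auto
qed

lemma vertex_on_edge:
  assumes "v \<in> set w"
  obtains a where "{v, a} \<in> set (walk_edges w)"
  using assms neighbour_iff set_eq_range_cyc[OF w_nonempty] by auto

text \<open>Two positions with the same edge either start at the same vertex, hence coincide, or
  traverse the edge in opposite directions; the latter makes the length divide 2, contrary to its
  being at least 3.\<close>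

lemma distinct_walk_edges: "distinct (walk_edges w)"
  unfolding walk_edges_def distinct_map
proof (intro conjI inj_onI)
  fix i j assume ij: "i \<in> set [0..<length w]" "j \<in> set [0..<length w]"
    and "{w ! i, w ! (Suc i mod length w)} = {w ! j, w ! (Suc j mod length w)}"
  then have *: "{cyc w (int i), cyc w (int i + 1)} = {cyc w (int j), cyc w (int j + 1)}"
    using walk_edge_cyc by (metis atLeastLessThan_iff set_upt)
  have d: "int (length w) dvd x - y" if "cyc w x = cyc w y" for x y
    using cyc_eq_imp_dvd[OF w_nonempty distinct_w that] .
  show "i = j"
  proof (cases "cyc w (int i) = cyc w (int j)")
    case True
    then show ?thesis using cyc_eq_small[of "int i" "int j"] ij by auto
  next
    case False
    with * have "cyc w (int i) = cyc w (int j + 1)" "cyc w (int i + 1) = cyc w (int j)"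
      by (auto simp: doubleton_eq_iff)
    then have "int (length w) dvd (int i + 1 - int j) - (int i - (int j + 1))"
      by (intro dvd_diff d)
    then have "int (length w) dvd 2" by simp
    then show ?thesis using length_w zdvd_imp_le[of "int (length w)" 2] by auto
  qed
qed simp

lemma card_walk_edges: "card (set (walk_edges w)) = length w"
  using distinct_card[OF distinct_walk_edges] by (simp add: walk_edges_def)

end

section \<open>The closed curve of a cycle\<close>

lemma edge_point_0 [simp]: "edge_point u v 0 = vertex_point u"
  by (simp add: edge_point_def)

lemma edge_point_1 [simp]: "edge_point u v 1 = vertex_point v"
  by (simp add: edge_point_def)

lemma edge_point_swap: "edge_point u v t = edge_point v u (1 - t)"
  by (auto simp: edge_point_def)

lemma edge_point_comp_inv:
  assumes "bij f"
  shows "edge_point u v t \<circ> inv f = edge_point (f u) (f v) t"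
proof -
  have "inv f x = u \<longleftrightarrow> x = f u" for x u
    using assms by (metis bij_inv_eq_iff)
  then show ?thesis by (auto simp: edge_point_def vertex_point_def fun_eq_iff)
qed

lemma Arg2pi_cis: "Arg2pi (cis t) = 2 * pi * frac (t / (2 * pi))"
proof (rule Arg2pi_unique[of 1])
  have "cis (2 * pi * frac (t / (2 * pi))) = cis (t - 2 * pi * real_of_int \<lfloor>t / (2 * pi)\<rfloor>)"
    by (simp add: frac_def right_diff_distrib)
  also have "\<dots> = cis t" 
    by (simp add: cis_divide[symmetric] cis_multiple_2pi)
  finally show "complex_of_real 1 * exp (\<i> * complex_of_real (2 * pi * frac (t / (2 * pi)))) = cis t"
    by (simp add: cis_conv_exp)
  show "2 * pi * frac (t / (2 * pi)) < 2 * pi"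
    using frac_lt_1[of "t / (2 * pi)"] by simp
qed auto

text \<open>Here \<open>t\<close> is any real and may wind around the circle several times, whereas
  \<open>Arg2pi\<close> is confined to one period. Reducing \<open>t\<close> modulo the length
  changes neither its fractional part nor the cyclic indices.\<close>

lemma walk_curve_cis:
  assumes "w \<noteq> []"
  shows "walk_curve w (cis (2 * pi * t / real (length w))) =
    edge_point (cyc w \<lfloor>t\<rfloor>) (cyc w (\<lfloor>t\<rfloor> + 1)) (frac t)"
proof -
  define m where "m = length w"
  have m: "m > 0" using assms by (simp add: m_def)
  define s where "s = real m * Arg2pi (cis (2 * pi * t / real m)) / (2 * pi)"
  have fl: "\<lfloor>t / real m\<rfloor> = \<lfloor>t\<rfloor> div int m"
    using floor_divide_real_eq_div[of "int m" t] by simp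
  have "s = real m * frac (t / real m)"
    by (simp add: s_def Arg2pi_cis)
  also have "\<dots> = t - real_of_int (int m * (\<lfloor>t\<rfloor> div int m))"
    using m by (simp add: frac_def fl right_diff_distrib)
  finally have s: "s = t - real_of_int (int m * (\<lfloor>t\<rfloor> div int m))" .
  have fs: "\<lfloor>s\<rfloor> = \<lfloor>t\<rfloor> mod int m"
    unfolding s floor_diff_of_int by (simp add: minus_mult_div_eq_mod)
  have fr: "frac s = frac t"
    unfolding s frac_def floor_diff_of_int by simp
  define i where "i = nat \<lfloor>s\<rfloor>"
  have "int i = \<lfloor>t\<rfloor> mod int m" "i < m" using m by (auto simp: i_def fs nat_less_iff)
  moreover from this have "int (Suc i mod m) = (\<lfloor>t\<rfloor> + 1) mod int m"
    by (simp add: zmod_int mod_simps add.commute)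
  ultimately have "w ! i = cyc w \<lfloor>t\<rfloor>" "w ! (Suc i mod m) = cyc w (\<lfloor>t\<rfloor> + 1)"
    unfolding cyc_def m_def[symmetric] by (metis nat_int)+
  then show ?thesis
    unfolding walk_curve_def Let_def m_def[symmetric] s_def[symmetric] i_def[symmetric] fr by simp
qed

text \<open>The curve depends only on the argument of \<open>z\<close> and is constant along rays
  from the origin; this makes the disk a cone over its boundary.\<close>

lemma walk_curve_of_real: "0 < r \<Longrightarrow> walk_curve w (of_real r * z) = walk_curve w z"
  by (simp add: walk_curve_def)

lemma walk_curve_sgn:
  assumes "z \<noteq> 0"
  shows "walk_curve w (sgn z) = walk_curve w z"
  using assms walk_curve_of_real[of "inverse (norm z)" w z]
  by (simp add: sgn_div_norm scaleR_conv_of_real)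

lemma unit_circle_param:
  assumes "norm z = 1" "0 < m"
  obtains t where "z = cis (2 * pi * t / m)"
proof
  show "z = cis (2 * pi * (m * Arg2pi z / (2 * pi)) / m)"
    using assms Arg2pi_eq[of z] by (simp add: cis_conv_exp)
qed

lemma walk_curve_in_realization:
  "w \<noteq> [] \<Longrightarrow> walk_curve w z \<in> graph_realization {} (set (walk_edges w))"
  by (rule walk_curve_in_graph_realization) (simp add: closed_walk_def)

lemma edge_point_bounds: "0 \<le> t \<Longrightarrow> t \<le> 1 \<Longrightarrow> 0 \<le> edge_point u v t x \<and> edge_point u v t x \<le> 1"
  by (auto simp: edge_point_def vertex_point_def)

lemma walk_curve_bounds: "w \<noteq> [] \<Longrightarrow> 0 \<le> walk_curve w z x \<and> walk_curve w z x \<le> 1"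
  using walk_curve_in_realization[of w z] edge_point_bounds by (fastforce simp: graph_realization_def)

context cycle
begin

lemma walk_curve_surj:
  assumes "x \<in> graph_realization {} (set (walk_edges w))"
  obtains z where "norm z = 1" "walk_curve w z = x"
proof -
  from assms obtain u v t where x: "x = edge_point u v t" "{u, v} \<in> set (walk_edges w)" "0 \<le> t" "t \<le> 1"
    by (auto simp: graph_realization_def)
  then obtain k where "{u, v} = {cyc w k, cyc w (k + 1)}"
    by (auto simp: set_walk_edges[OF w_nonempty])
  then obtain s where s: "x = edge_point (cyc w k) (cyc w (k + 1)) s" "0 \<le> s" "s \<le> 1"
    using x edge_point_swap[of u v t] by (force simp: doubleton_eq_iff)
  have "walk_curve w (cis (2 * pi * (real_of_int k + s) / real (length w))) = x"
  \<comment> \<open>At \<open>s = 1\<close> the floor already belongs to the next step, whose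
    starting vertex is the same point.\<close>
  proof (cases "s = 1")
    case True
    have "real_of_int k + 1 = of_int (k + 1)" by simp
    then show ?thesis
      unfolding walk_curve_cis[OF w_nonempty] True s(1) by (simp only: floor_of_int frac_of_int) simp
  next
    case False
    with s have "\<lfloor>real_of_int k + s\<rfloor> = k" "frac (real_of_int k + s) = s"
      by (auto simp: floor_eq_iff frac_eq frac_def)
    then show ?thesis unfolding walk_curve_cis[OF w_nonempty] s(1) by simp
  qed
  then show thesis using that by (metis norm_cis)
qed

text \<open>Since both parameters are below 1, the coordinate at the starting vertex of each step is
  positive, so each starting vertex is an end of the other edge. Opposite orientations would again
  make the length divide 2. The half-open range fixes which step a vertex belongs to.\<close>

lemma edge_point_cyc_inj:
  assumes eq: "edge_point (cyc w i) (cyc w (i + 1)) s = edge_point (cyc w j) (cyc w (j + 1)) t"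
    and s: "0 \<le> s" "s < 1" and t: "0 \<le> t" "t < 1"
  shows "cyc w i = cyc w j \<and> s = t"
proof -
  have i: "cyc w i \<in> {cyc w j, cyc w (j + 1)}"
    using fun_cong[OF eq, of "cyc w i"] s t next_neq[of i]
    by (auto simp: edge_point_def vertex_point_def split: if_splits)
  have j: "cyc w j \<in> {cyc w i, cyc w (i + 1)}"
    using fun_cong[OF eq, of "cyc w j"] s t next_neq[of j]
    by (auto simp: edge_point_def vertex_point_def split: if_splits)
  have "cyc w i = cyc w j"
  proof (rule ccontr)
    assume "\<not> ?thesis"
    with i j have "cyc w i = cyc w (j + 1)" "cyc w (i + 1) = cyc w j" by auto
    then have "int (length w) dvd (i + 1 - j) - (i - (j + 1))"
      by (intro dvd_diff cyc_eq_imp_dvd[OF w_nonempty distinct_w])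
    then show False using length_w zdvd_imp_le[of "int (length w)" 2] by auto
  qed
  then show ?thesis
    using fun_cong[OF eq, of "cyc w i"] next_neq[of i] next_neq[of j]
    by (auto simp: edge_point_def vertex_point_def)
qed

text \<open>Times with the same image have equal fractional parts and congruent floors, so they
  differ by a multiple of the length, that is, by full turns of the circle.\<close>

lemma walk_curve_inj:
  assumes "norm y = 1" "norm z = 1" "walk_curve w y = walk_curve w z"
  shows "y = z"
proof -
  define m where "m = real (length w)"
  have m: "m > 0" using w_nonempty by (simp add: m_def)
  obtain s t where st: "y = cis (2 * pi * s / m)" "z = cis (2 * pi * t / m)"
    using unit_circle_param[OF _ m] assms(1,2) by metis
  have "edge_point (cyc w \<lfloor>s\<rfloor>) (cyc w (\<lfloor>s\<rfloor> + 1)) (frac s) =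
      edge_point (cyc w \<lfloor>t\<rfloor>) (cyc w (\<lfloor>t\<rfloor> + 1)) (frac t)"
    using assms(3) unfolding st m_def walk_curve_cis[OF w_nonempty] .
  from edge_point_cyc_inj[OF this] have "cyc w \<lfloor>s\<rfloor> = cyc w \<lfloor>t\<rfloor>" and fr: "frac s = frac t"
    by (auto simp: frac_lt_1)
  then have "int (length w) dvd \<lfloor>s\<rfloor> - \<lfloor>t\<rfloor>"
    using cyc_eq_imp_dvd[OF w_nonempty distinct_w] by blast
  then obtain k where k: "\<lfloor>s\<rfloor> - \<lfloor>t\<rfloor> = int (length w) * k" by (auto elim: dvdE)
  have "s - t = of_int (\<lfloor>s\<rfloor> - \<lfloor>t\<rfloor>)" using fr by (simp add: frac_def)
  then have "s - t = m * of_int k" unfolding k by (simp add: m_def)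
  then have "2 * pi * s / m = 2 * pi * t / m + 2 * pi * of_int k"
    using m by (simp add: field_simps)
  then show ?thesis unfolding st by (simp add: cis_mult[symmetric] cis_multiple_2pi)
qed

text \<open>The right-hand side is a tent function: \<open>arccos\<close> gives the angular distance
  of \<open>z\<close> from the position of vertex \<open>k\<close> on the circle, measured here in
  steps of the walk. It turns a definition by floors and arguments into a visibly continuous
  formula.\<close>

lemma walk_curve_vertex_coordinate:
  assumes z: "norm z = 1"
  shows "walk_curve w z (cyc w k) =
    max 0 (1 - real (length w) / (2 * pi) *
      arccos (Re (z * cnj (cis (2 * pi * real_of_int k / real (length w))))))"
proof -
  define m where "m = real (length w)"
  have m: "m \<ge> 3" using length_w by (simp add: m_def)
  define u where "u = z * cnj (cis (2 * pi * real_of_int k / m))"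
  have nu: "norm u = 1" by (simp add: u_def norm_mult z)
  \<comment> \<open>The signed angle from vertex \<open>k\<close> to \<open>z\<close>; rescaled to
    \<open>s\<close>, it counts steps forwards or backwards along the walk.\<close>
  define \<phi> where "\<phi> = Arg u"
  have phi: "u = cis \<phi>" "-pi < \<phi>" "\<phi> \<le> pi"
    using nu Arg_bounded[of u] Arg_eq[of u] by (cases "u = 0"; auto simp: \<phi>_def cis_conv_exp)+
  define s where "s = m * \<phi> / (2 * pi)"
  have phis: "\<phi> = 2 * pi * s / m" using m by (simp add: s_def)
  have arc: "m / (2 * pi) * arccos (Re u) = \<bar>s\<bar>"
  proof -
    have "arccos (Re u) = \<bar>\<phi>\<bar>"
      unfolding phi(1) cis.simps using phi(2,3) arccos_cos[of \<phi>] arccos_cos[of "-\<phi>"]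
      by (cases "\<phi> \<ge> 0") auto
    then show ?thesis using m by (simp add: s_def abs_mult)
  qed
  have s: "\<bar>s\<bar> \<le> m / 2"
    unfolding s_def using m phi by (simp add: abs_mult field_simps)
  have "z = u * cis (2 * pi * real_of_int k / m)"
    unfolding u_def by (simp add: mult.assoc mult.commute[of "cnj _"] complex_norm_square[symmetric])
  also have "\<dots> = cis (2 * pi * (real_of_int k + s) / m)"
    unfolding phi(1) phis cis_mult by (simp add: add_divide_distrib ring_distribs add.commute)
  finally have "z = cis (2 * pi * (real_of_int k + s) / m)" .
  then have "walk_curve w z = edge_point (cyc w (k + \<lfloor>s\<rfloor>)) (cyc w (k + \<lfloor>s\<rfloor> + 1)) (frac s)"
    unfolding m_def by (simp add: walk_curve_cis[OF w_nonempty] frac_def)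
  moreover have "edge_point (cyc w (k + \<lfloor>s\<rfloor>)) (cyc w (k + \<lfloor>s\<rfloor> + 1)) (frac s) (cyc w k) = max 0 (1 - \<bar>s\<bar>)"
  proof -
    \<comment> \<open>The bound of half the length on \<open>s\<close> and a length of at least 3
      keep the far cases from wrapping around to vertex \<open>k\<close>, so the coordinate vanishes
      there.\<close>
    have ne: "cyc w (k + d) \<noteq> cyc w k" if "d \<noteq> 0" "\<bar>d\<bar> < int (length w)" for d
      using cyc_eq_small[of "k + d" k] that by auto
    consider "\<lfloor>s\<rfloor> = 0" | "\<lfloor>s\<rfloor> = -1" | "\<lfloor>s\<rfloor> \<ge> 1" | "\<lfloor>s\<rfloor> \<le> -2" by linarith
    then show ?thesis
    proof cases
      case 1
      then have "0 \<le> s" "s < 1" by linarith+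
      then show ?thesis using 1 next_neq[of k]
        by (simp add: edge_point_def vertex_point_def frac_def)
    next
      case 2
      then have "-1 \<le> s" "s < 0" by linarith+
      then show ?thesis using 2 next_neq[of k]
        by (simp add: edge_point_def vertex_point_def frac_def)
    next
      case 3
      have "real_of_int \<lfloor>s\<rfloor> + 1 < m" using s m of_int_floor_le[of s] by linarith
      then have "\<lfloor>s\<rfloor> + 1 < int (length w)" unfolding m_def by linarith
      with 3 have "cyc w (k + \<lfloor>s\<rfloor>) \<noteq> cyc w k" "cyc w (k + (\<lfloor>s\<rfloor> + 1)) \<noteq> cyc w k"
        by (intro ne; linarith)+
      moreover have "s \<ge> 1" using 3 by linarith
      ultimately show ?thesis by (auto simp: edge_point_def vertex_point_def add.assoc)
    next
      case 4
      have "real_of_int (2 * \<lfloor>s\<rfloor>) > - m - 2" using s by linarith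
      then have "2 * \<lfloor>s\<rfloor> > - int (length w) - 2" unfolding m_def by linarith
      then have "\<lfloor>s\<rfloor> > - int (length w)" using length_w by linarith
      with 4 have "cyc w (k + \<lfloor>s\<rfloor>) \<noteq> cyc w k" "cyc w (k + (\<lfloor>s\<rfloor> + 1)) \<noteq> cyc w k"
        by (intro ne; linarith)+
      moreover have "s \<le> -1" using 4 by linarith
      ultimately show ?thesis by (auto simp: edge_point_def vertex_point_def add.assoc)
    qed
  qed
  ultimately show ?thesis
    unfolding m_def[symmetric] u_def[symmetric] arc by simp
qed

lemma walk_curve_outside:
  assumes "v \<notin> set w"
  shows "walk_curve w z v = 0"
proof -
  obtain a b t where "walk_curve w z = edge_point a b t" "{a, b} \<in> set (walk_edges w)"
    using walk_curve_in_realization[OF w_nonempty, of z] by (auto simp: graph_realization_def)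
  then show ?thesis
    using edge_subset[of "{a, b}"] assms by (auto simp: edge_point_def vertex_point_def)
qed

lemma continuous_on_walk_curve_coordinate:
  "continuous_on (sphere 0 1) (\<lambda>z. walk_curve w z v)"
proof (cases "v \<in> set w")
  case True
  then obtain k where k: "v = cyc w k" using set_eq_range_cyc[OF w_nonempty] by auto
  define c where "c = cnj (cis (2 * pi * real_of_int k / real (length w)))"
  have c: "norm c = 1" by (simp add: c_def)
  have "continuous_on (sphere 0 1) (\<lambda>z. max 0 (1 - real (length w) / (2 * pi) * arccos (Re (z * c))))"
  proof (intro continuous_intros ballI)
    fix z :: complex assume "z \<in> sphere 0 1"
    then have "\<bar>Re (z * c)\<bar> \<le> 1"
      using abs_Re_le_cmod[of "z * c"] c by (simp add: norm_mult)
    then show "-1 \<le> Re (z * c) \<and> Re (z * c) \<le> 1" by linarith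
  qed
  then show ?thesis
  proof (rule continuous_on_eq)
    fix z :: complex assume "z \<in> sphere 0 1"
    then show "max 0 (1 - real (length w) / (2 * pi) * arccos (Re (z * c))) = walk_curve w z v"
      using walk_curve_vertex_coordinate[of z k] by (simp add: k c_def)
  qed
next
  case False
  then show ?thesis by (simp add: walk_curve_outside)
qed

text \<open>Away from the origin this is continuity on the circle composed with \<open>sgn\<close>;
  at the origin, where the curve has no limit, the factor \<open>norm z\<close> squeezes the product
  to 0 because coordinates lie between 0 and 1.\<close>

lemma continuous_on_cone_coordinate:
  "continuous_on UNIV (\<lambda>z. norm z * walk_curve w z v)"
proof -
  have "isCont (\<lambda>z. norm z * walk_curve w z v) z" for z
  proof (cases "z = 0")
    case True
    have "((\<lambda>z. norm z * walk_curve w z v) \<longlongrightarrow> 0) (at 0)"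
    proof (rule Lim_null_comparison)
      show "\<forall>\<^sub>F z in at 0. norm (norm z * walk_curve w z v) \<le> norm z"
        using walk_curve_bounds[OF w_nonempty, of _ v] by (simp add: mult_left_le abs_mult)
      show "(norm \<longlongrightarrow> 0) (at (0::complex))" by (rule tendsto_norm_zero) simp
    qed
    then show ?thesis using True by (simp add: isCont_def)
  next
    case False
    have "continuous_on (- {0}) (\<lambda>z. walk_curve w (sgn z) v)"
      by (rule continuous_on_compose2[OF continuous_on_walk_curve_coordinate])
        (auto intro!: continuous_intros simp: norm_sgn split: if_splits)
    then have "continuous_on (- {0}) (\<lambda>z. walk_curve w z v)"
      by (rule continuous_on_eq) (simp add: walk_curve_sgn)
    then have "continuous_on (- {0}) (\<lambda>z. norm z * walk_curve w z v)"
      by (intro continuous_intros)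
    then show ?thesis using False continuous_on_eq_continuous_at[of "- {0}"] by auto
  qed
  then show ?thesis by (simp add: continuous_at_imp_continuous_on)
qed

end


section \<open>Cone coordinates\<close>

text \<open>A disk attached along \<open>w\<close> is the cone over the curve of \<open>w\<close>: the coordinates of a point are
  its barycentric vertex coordinates, scaled by the radius, and its height above the graph, recorded
  in a coordinate of its own for every walk.\<close>

definition cone_point :: "'a list \<Rightarrow> complex \<Rightarrow> ('a \<Rightarrow> real) \<times> ('a list \<Rightarrow> real)" where
  "cone_point w z = (\<lambda>u. norm z * walk_curve w z u, \<lambda>w'. if w' = w then 1 - norm z else 0)"

definition cone_coords :: "'a map_point \<Rightarrow> ('a \<Rightarrow> real) \<times> ('a list \<Rightarrow> real)" where
  "cone_coords p = (case p of Inl x \<Rightarrow> (x, \<lambda>_. 0) | Inr (w, z) \<Rightarrow> cone_point w z)"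

definition cone_space :: "'a list set \<Rightarrow> (('a \<Rightarrow> real) \<times> ('a list \<Rightarrow> real)) set" where
  "cone_space T = (\<Union>w\<in>T. cone_point w ` cball 0 1)"

lemma cone_coords_Inl [simp]: "cone_coords (Inl x) = (x, \<lambda>_. 0)"
  by (simp add: cone_coords_def)

lemma cone_coords_Inr [simp]: "cone_coords (Inr (w, z)) = cone_point w z"
  by (simp add: cone_coords_def)

lemma cone_coords_disk_map: "norm z \<le> 1 \<Longrightarrow> cone_coords (disk_map w z) = cone_point w z"
  by (auto simp: disk_map_def cone_point_def)

lemma Hausdorff_space_fun: "Hausdorff_space (euclidean :: ('a \<Rightarrow> real) topology)"
  by (simp add: Hausdorff_space_product_topology flip: euclidean_product_topology)

lemma Hausdorff_space_coordinates:
  "Hausdorff_space (euclidean :: (('a \<Rightarrow> real) \<times> ('b \<Rightarrow> real)) topology)"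
  by (simp add: Hausdorff_space_prod_topology Hausdorff_space_fun flip: prod_topology_euclidean)

context cycle
begin

lemma continuous_on_cone_point: "continuous_on A (cone_point w)"
proof -
  have "continuous_on A (\<lambda>z. norm z * walk_curve w z u)" for u
    by (rule continuous_on_subset[OF continuous_on_cone_coordinate subset_UNIV])
  moreover have "continuous_on A (\<lambda>z::complex. if w' = w then 1 - norm z else 0)" for w'
    by (cases "w' = w") (simp_all add: continuous_on_diff continuous_on_norm_id)
  ultimately show ?thesis
    unfolding cone_point_def[abs_def]
    by (intro continuous_on_Pair continuous_on_coordinatewise_then_product)
qed

text \<open>The height at \<open>w\<close> recovers the radius; if that is not 0, dividing by it
  recovers the boundary point and hence the direction.\<close>

lemma cone_point_inj:
  assumes "norm y \<le> 1" "norm z \<le> 1" "cone_point w y = cone_point w z"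
  shows "y = z"
proof -
  have n: "norm y = norm z"
    using fun_cong[OF arg_cong[OF assms(3), of snd], of w] by (simp add: cone_point_def)
  show ?thesis
  proof (cases "z = 0")
    case True
    with n show ?thesis by simp
  next
    case False
    with n have "y \<noteq> 0" by auto
    have "walk_curve w y = walk_curve w z"
      using fun_cong[OF arg_cong[OF assms(3), of fst]] n False by (simp add: cone_point_def fun_eq_iff)
    then have "sgn y = sgn z"
      using False \<open>y \<noteq> 0\<close> walk_curve_inj[of "sgn y" "sgn z"] by (simp add: walk_curve_sgn norm_sgn)
    then show ?thesis using n False by (simp add: sgn_div_norm)
  qed
qed

text \<open>The cone in terms of a base point \<open>x\<close> and a height
  \<open>h = 1 - norm z\<close>. Later arguments use this form and need no complex
  parameter.\<close>

lemma cone_point_image: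
  "cone_point w ` cball 0 1 = {(\<lambda>u. (1 - h) * x u, \<lambda>w'. if w' = w then h else 0) |x h.
      x \<in> graph_realization {} (set (walk_edges w)) \<and> 0 \<le> h \<and> h \<le> 1}" (is "?L = ?R")
proof
  show "?L \<subseteq> ?R"
  proof
    fix p assume "p \<in> ?L"
    then obtain z where z: "norm z \<le> 1" "p = cone_point w z" by auto
    then have "p = (\<lambda>u. (1 - (1 - norm z)) * walk_curve w z u, \<lambda>w'. if w' = w then 1 - norm z else 0)"
      by (simp add: cone_point_def)
    then show "p \<in> ?R"
      using walk_curve_in_realization[OF w_nonempty, of z] z(1)
      by (intro CollectI exI[of _ "walk_curve w z"] exI[of _ "1 - norm z"]) simp
  qed
  show "?R \<subseteq> ?L"
  proof
    fix p assume "p \<in> ?R"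
    then obtain x h where p: "p = (\<lambda>u. (1 - h) * x u, \<lambda>w'. if w' = w then h else 0)"
      and x: "x \<in> graph_realization {} (set (walk_edges w))" and h: "0 \<le> h" "h \<le> 1" by blast
    obtain z where z: "norm z = 1" "walk_curve w z = x" using walk_curve_surj[OF x] .
    have n: "norm (of_real (1 - h) * z) = 1 - h"
      using h z by (simp add: norm_mult del: of_real_diff)
    have "p = cone_point w (of_real (1 - h) * z)"
    \<comment> \<open>At the apex the direction is lost: every base point is scaled to 0, so the
      choice of \<open>z\<close> does not matter.\<close>
    proof (cases "h = 1")
      case False
      with h have "walk_curve w (of_real (1 - h) * z) = x"
        using walk_curve_of_real[of "1 - h" w z] z by simp
      then show ?thesis unfolding cone_point_def n p by (simp add: fun_eq_iff)
    qed (simp add: p cone_point_def fun_eq_iff)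
    then show "p \<in> ?L" using n h(1) by simp
  qed
qed

end

section \<open>Cubic graphs in which every corner lies on one face\<close>

text \<open>\<open>corner\<close> is the local condition that makes the disks close up around a
  vertex: its three corners are each filled by exactly one face. The topological part needs only
  this, not that the faces are girth cycles.\<close>

locale cubic_face_system =
  fixes V :: "'a set" and E :: "'a set set" and T :: "'a list set"
  assumes simple: "simple_graph V E"
    and conn: "connected_graph V E"
    and finite_T: "finite T"
    and cycle_T: "w \<in> T \<Longrightarrow> cycle_walk E w"
    and cubic: "v \<in> V \<Longrightarrow> \<exists>a b c. distinct [a, b, c] \<and> {y. {v, y} \<in> E} = {a, b, c}"
    and corner: "\<lbrakk>{v, a} \<in> E; {v, b} \<in> E; a \<noteq> b\<rbrakk> \<Longrightarrow>
      \<exists>!w. w \<in> T \<and> {v, a} \<in> set (walk_edges w) \<and> {v, b} \<in> set (walk_edges w)"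
begin

lemma is_cycle: "w \<in> T \<Longrightarrow> cycle w"
  using cycle_T by (simp add: cycle_def cycle_walk_def)

lemma closed_walk_T: "w \<in> T \<Longrightarrow> closed_walk E w"
  using cycle_T by (simp add: cycle_walk_def)

lemma face_edges: "w \<in> T \<Longrightarrow> set (walk_edges w) \<subseteq> E"
  using closed_walk_T by (simp add: closed_walk_def)

lemma edge_ends: "{u, v} \<in> E \<Longrightarrow> u \<in> V \<and> v \<in> V \<and> u \<noteq> v"
  using simple by (force simp: simple_graph_def)

lemma face_vertices: "w \<in> T \<Longrightarrow> set w \<subseteq> V"
  using cycle.vertex_on_edge[OF is_cycle] face_edges edge_ends by (meson subsetI subsetD)

text \<open>At least two further edges leave \<open>u\<close>, so the edge is one side of a corner,
  and some face fills that corner.\<close>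

lemma edge_on_face:
  assumes "{u, v} \<in> E"
  obtains w where "w \<in> T" "{u, v} \<in> set (walk_edges w)"
proof -
  obtain a b c where abc: "distinct [a, b, c]" "{y. {u, y} \<in> E} = {a, b, c}"
    using cubic edge_ends[OF assms] by metis
  have "a \<noteq> v \<or> b \<noteq> v" using abc(1) by auto
  then obtain y where "y \<noteq> v" "{u, y} \<in> E" using abc(2) by blast
  with assms corner[of u v y] that show thesis by blast
qed

lemma graph_point_on_face:
  assumes "x \<in> graph_realization V E"
  obtains w where "w \<in> T" "x \<in> graph_realization {} (set (walk_edges w))"
proof -
  obtain u v t where uv: "{u, v} \<in> E" "0 \<le> t" "t \<le> 1" "x = edge_point u v t"
  proof (cases "x \<in> vertex_point ` V")
    case True
    then obtain v where v: "v \<in> V" "x = vertex_point v" by auto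
    then obtain y where "{v, y} \<in> E" using cubic[of v] by blast
    then show thesis using that[of v y 0] v by simp
  next
    case False
    then show thesis using assms that by (auto simp: graph_realization_def)
  qed
  then show thesis using edge_on_face[OF uv(1)] that by (force simp: graph_realization_def)
qed

lemma mem_cone_space:
  "p \<in> cone_space T \<longleftrightarrow> (\<exists>w x h. w \<in> T \<and> x \<in> graph_realization {} (set (walk_edges w)) \<and>
     0 \<le> h \<and> h \<le> 1 \<and> p = (\<lambda>u. (1 - h) * x u, \<lambda>w'. if w' = w then h else 0))"
  (is "_ \<longleftrightarrow> (\<exists>w x h. w \<in> T \<and> ?P w x h)")
proof -
  have "p \<in> cone_point w ` cball 0 1 \<longleftrightarrow> (\<exists>x h. ?P w x h)" if "w \<in> T" for w
    unfolding cycle.cone_point_image[OF is_cycle[OF that]] by blast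
  then show ?thesis unfolding cone_space_def UN_iff by blast
qed

lemma topspace_X: "topspace (map_space V E T) = map_points V E T"
  using topspace_map_space closed_walk_T by blast

lemma disk_map_in_X: "w \<in> T \<Longrightarrow> norm z \<le> 1 \<Longrightarrow> disk_map w z \<in> map_points V E T"
  using walk_curve_in_graph_realization[OF closed_walk_T]
  by (auto simp: disk_map_def map_points_def)

lemma map_points_disks: "map_points V E T = (\<Union>w\<in>T. disk_map w ` cball 0 1)"
proof
  show "(\<Union>w\<in>T. disk_map w ` cball 0 1) \<subseteq> map_points V E T"
    using disk_map_in_X by auto
  show "map_points V E T \<subseteq> (\<Union>w\<in>T. disk_map w ` cball 0 1)"
  proof
    fix p assume "p \<in> map_points V E T"
    then consider x where "p = Inl x" "x \<in> graph_realization V E"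
      | w z where "p = Inr (w, z)" "w \<in> T" "norm z < 1"
      by (auto simp: map_points_def)
    then show "p \<in> (\<Union>w\<in>T. disk_map w ` cball 0 1)"
    proof cases
      case 1
      obtain w where w: "w \<in> T" "x \<in> graph_realization {} (set (walk_edges w))"
        using graph_point_on_face[OF 1(2)] .
      obtain z where "norm z = 1" "walk_curve w z = x"
        using cycle.walk_curve_surj[OF is_cycle[OF w(1)] w(2)] .
      then have "p = disk_map w z" "z \<in> cball 0 1" using 1 by (auto simp: disk_map_def)
      then show ?thesis using w by blast
    next
      case 2
      then have "p = disk_map w z" "z \<in> cball 0 1" by (auto simp: disk_map_def)
      then show ?thesis using 2 by blast
    qed
  qed
qed

lemma cone_coords_image: "cone_coords ` map_points V E T = cone_space T"
proof -
  have "cone_coords ` map_points V E T = (\<Union>w\<in>T. (\<lambda>z. cone_coords (disk_map w z)) ` cball 0 1)"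
    unfolding map_points_disks by (auto simp: image_UN image_image)
  also have "\<dots> = cone_space T"
    unfolding cone_space_def by (intro SUP_cong image_cong refl) (simp add: cone_coords_disk_map)
  finally show ?thesis .
qed

lemma continuous_map_disk_map:
  assumes "w \<in> T"
  shows "continuous_map (top_of_set (cball 0 1)) (map_space V E T) (disk_map w)"
  unfolding continuous_map_def topspace_X openin_map_space map_open_def
  using assms disk_map_in_X by auto

text \<open>Every graph point lies on the boundary of some face, so the space is the union of
  finitely many continuous images of the closed disk.\<close>

lemma compact_space_X: "compact_space (map_space V E T)"
proof -
  have "compactin (map_space V E T) (disk_map w ` cball 0 1)" if "w \<in> T" for w
    by (rule image_compactin[OF _ continuous_map_disk_map[OF that]])
      (simp add: compactin_subtopology)
  then have "compactin (map_space V E T) (\<Union>w\<in>T. disk_map w ` cball 0 1)"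
    by (intro compactin_Union) (auto simp: finite_T)
  then show ?thesis by (simp add: compact_space_def topspace_X map_points_disks)
qed

text \<open>By the definition of the quotient topology it suffices to test preimages on the graph
  and on each closed disk, where the coordinates are already known to be continuous.\<close>

lemma continuous_map_cone_coords: "continuous_map (map_space V E T) euclidean cone_coords"
  unfolding continuous_map_def topspace_X openin_map_space map_open_def
proof (intro conjI allI impI ballI)
  fix O' :: "(('a \<Rightarrow> real) \<times> ('a list \<Rightarrow> real)) set" assume "openin euclidean O'"
  then have O': "open O'" by simp
  show "openin (top_of_set (graph_realization V E))
      {x \<in> graph_realization V E. Inl x \<in> {p \<in> map_points V E T. cone_coords p \<in> O'}}"
  proof -
    have "continuous_on (graph_realization V E) (\<lambda>x. (x, \<lambda>_. 0) :: ('a \<Rightarrow> real) \<times> ('a list \<Rightarrow> real))"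
      by (intro continuous_intros)
    from continuous_openin_preimage_gen[OF this O']
    have "openin (top_of_set (graph_realization V E)) {x \<in> graph_realization V E. (x, \<lambda>_. 0) \<in> O'}"
      by (simp add: vimage_def Int_def)
    moreover have "{x \<in> graph_realization V E. Inl x \<in> {p \<in> map_points V E T. cone_coords p \<in> O'}} =
        {x \<in> graph_realization V E. (x, \<lambda>_. 0) \<in> O'}"
      by (auto simp: map_points_def)
    ultimately show ?thesis by simp
  qed
  fix w assume w: "w \<in> T"
  have "openin (top_of_set (cball 0 1)) {z \<in> cball 0 1. cone_point w z \<in> O'}"
    using continuous_openin_preimage_gen[OF cycle.continuous_on_cone_point[OF is_cycle[OF w]] O', of "cball 0 1"]
    by (simp only: vimage_def Int_def mem_Collect_eq)
  moreover have "{z \<in> cball 0 1. disk_map w z \<in> {p \<in> map_points V E T. cone_coords p \<in> O'}} =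
      {z \<in> cball 0 1. cone_point w z \<in> O'}"
    using w disk_map_in_X by (auto simp: cone_coords_disk_map)
  ultimately show "openin (top_of_set (cball 0 1))
      {z \<in> cball 0 1. disk_map w z \<in> {p \<in> map_points V E T. cone_coords p \<in> O'}}" by simp
qed auto

text \<open>Graph points have height 0 everywhere, whereas a point of an open disk has positive
  height exactly at its own face. This separates the cells; within a disk \<open>cone_point\<close>
  is injective.\<close>

lemma inj_cone_coords: "inj_on cone_coords (map_points V E T)"
proof (rule inj_onI)
  fix p q assume pq: "p \<in> map_points V E T" "q \<in> map_points V E T" "cone_coords p = cone_coords q"
  have ne: False if "cone_point w z = (x, \<lambda>_. 0)" "norm z < 1" for w :: "'a list" and z x
    using fun_cong[OF arg_cong[OF that(1), of snd], of w] that(2) by (simp add: cone_point_def)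
  have eq: "w = w'" if "cone_point w z = cone_point w' z'" "norm z < 1" for w w' :: "'a list" and z z'
    using fun_cong[OF arg_cong[OF that(1), of snd], of w] that(2)
    by (auto simp: cone_point_def split: if_splits)
  have eq2: "z = z'" if "cone_point w z = cone_point w z'" "norm z < 1" "norm z' < 1" "w \<in> T" for w z z'
    using cycle.cone_point_inj[OF is_cycle[OF that(4)] _ _ that(1)] that by simp
  have cases: "(\<exists>x. p = Inl x) \<or> (\<exists>w z. p = Inr (w, z) \<and> w \<in> T \<and> norm z < 1)"
    if "p \<in> map_points V E T" for p
    using that by (auto simp: map_points_def)
  consider x y where "p = Inl x" "q = Inl y"
    | x w z where "p = Inl x" "q = Inr (w, z)" "norm z < 1"
    | x w z where "q = Inl x" "p = Inr (w, z)" "norm z < 1"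
    | w z w' z' where "p = Inr (w, z)" "norm z < 1" "w \<in> T" "q = Inr (w', z')" "norm z' < 1"
    using cases[OF pq(1)] cases[OF pq(2)] by blast
  then show "p = q"
  proof cases
    case 1
    then show ?thesis using pq(3) by simp
  next
    case 2
    then show ?thesis using pq(3) ne[of w z x] by simp
  next
    case 3
    then show ?thesis using pq(3) ne[of w z x] by simp
  next
    case 4
    then have "cone_point w z = cone_point w' z'" using pq(3) by simp
    then show ?thesis using 4 eq[of w z w' z'] eq2[of w z z'] by simp
  qed
qed

text \<open>A continuous bijection from a compact space onto a Hausdorff space is a homeomorphism.
  From here on the quotient can be replaced by a subset of a product of lines.\<close>

lemma cone_coords_homeomorphic:
  "homeomorphic_map (map_space V E T) (top_of_set (cone_space T)) cone_coords"
proof (rule continuous_imp_homeomorphic_map[OF _ compact_space_X])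
  show "continuous_map (map_space V E T) (top_of_set (cone_space T)) cone_coords"
    using continuous_map_cone_coords cone_coords_image
    by (auto simp: continuous_map_in_subtopology topspace_X)
  show "Hausdorff_space (top_of_set (cone_space T))"
    using Hausdorff_space_subtopology Hausdorff_space_coordinates by blast
qed (auto simp: topspace_X cone_coords_image inj_cone_coords)

end


section \<open>Transfer of the surface property along homeomorphisms\<close>

lemma closed_surface_homeomorphic:
  assumes f: "homeomorphic_map X Y f" and Y: "closed_surface Y"
  shows "closed_surface X"
proof -
  have XY: "X homeomorphic_space Y" using f homeomorphic_map_imp_homeomorphic_space by blast
  have "\<exists>U. openin X U \<and> x \<in> U \<and>
      (\<exists>W :: complex set. open W \<and> subtopology X U homeomorphic_space top_of_set W)"
    if x: "x \<in> topspace X" for x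
  proof -
    have "f x \<in> topspace Y" using f x homeomorphic_imp_surjective_map by blast
    then obtain U and W :: "complex set" where U: "openin Y U" "f x \<in> U"
      and W: "open W" "subtopology Y U homeomorphic_space top_of_set W"
      using Y unfolding closed_surface_def by meson
    let ?U = "{x \<in> topspace X. f x \<in> U}"
    have "openin X ?U"
      using homeomorphic_imp_continuous_map[OF f] U(1) by (simp add: continuous_map_def)
    moreover have "homeomorphic_map (subtopology X ?U) (subtopology Y U) f"
      by (rule homeomorphic_map_subtopologies_alt[OF f]) auto
    then have "subtopology X ?U homeomorphic_space top_of_set W"
      using W(2) homeomorphic_map_imp_homeomorphic_space homeomorphic_space_trans by blast
    ultimately show ?thesis using W(1) U(2) x by blast
  qed
  then show ?thesis
    using Y XY homeomorphic_compact_space homeomorphic_connected_space homeomorphic_Hausdorff_space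
    unfolding closed_surface_def by blast
qed

lemma homeomorphic_space_setI:
  assumes "continuous_on S f" "continuous_on T g" "\<And>x. x \<in> S \<Longrightarrow> f x \<in> T \<and> g (f x) = x"
    "\<And>y. y \<in> T \<Longrightarrow> g y \<in> S \<and> f (g y) = y"
  shows "top_of_set S homeomorphic_space top_of_set T"
  unfolding homeomorphic_space_def homeomorphic_maps_def
  using assms by (intro exI[of _ f] exI[of _ g]) (auto simp: continuous_map_in_subtopology)

text \<open>The fan of the projective plane: every point of the plane is \<open>p\<^sub>a (1, 0) + p\<^sub>b (0, 1) + p\<^sub>c (-1, -1)\<close>
  for exactly one triple of nonnegative numbers with minimum 0.  In the open star of a vertex with
  neighbours \<open>a\<close>, \<open>b\<close>, \<open>c\<close>, the edges are sent to the three rays and the apex of the face at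
  the corner \<open>a\<close>, \<open>b\<close> is sent to \<open>(1, 0) + (0, 1)\<close>.\<close>

definition fan_coords :: "complex \<Rightarrow> real \<times> real \<times> real" where
  "fan_coords z = (let m = min 0 (min (Re z) (Im z)) in (Re z - m, Im z - m, - m))"

definition star_chart ::
  "'a \<Rightarrow> 'a \<Rightarrow> 'a \<Rightarrow> 'b \<Rightarrow> 'b \<Rightarrow> 'b \<Rightarrow> ('a \<Rightarrow> real) \<times> ('b \<Rightarrow> real) \<Rightarrow> complex" where
  "star_chart a b c ab ac bc p =
     Complex (fst p a - fst p c + snd p ab - snd p bc) (fst p b - fst p c + snd p ab - snd p ac)"

text \<open>The inverse of \<open>star_chart\<close>: the smaller of two fan coordinates is the
  height in the face between their rays, the remainder on each ray goes to the neighbour, and the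
  coordinate at \<open>v\<close> makes the total 1.\<close>

definition star_param ::
  "'a \<Rightarrow> 'a \<Rightarrow> 'a \<Rightarrow> 'a \<Rightarrow> 'b \<Rightarrow> 'b \<Rightarrow> 'b \<Rightarrow> complex \<Rightarrow> ('a \<Rightarrow> real) \<times> ('b \<Rightarrow> real)" where
  "star_param v a b c ab ac bc z = (case fan_coords z of (pa, pb, pc) \<Rightarrow>
     (\<lambda>u. if u = v then 1 - max pa (max pb pc)
          else if u = a then pa - min pa pb - min pa pc
          else if u = b then pb - min pa pb - min pb pc
          else if u = c then pc - min pa pc - min pb pc else 0,
      \<lambda>w. if w = ab then min pa pb else if w = ac then min pa pc
          else if w = bc then min pb pc else 0))"

text \<open>An open set in the plane: the inequality says that \<open>star_param\<close> gives
  \<open>v\<close> a positive coordinate.\<close>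

definition star_region :: "complex set" where
  "star_region = {z. case fan_coords z of (pa, pb, pc) \<Rightarrow> max pa (max pb pc) < 1}"

text \<open>Barycentric coordinates \<open>1 - r\<close>, \<open>r - s\<close>, \<open>s\<close>
  with respect to \<open>v\<close>, the neighbour \<open>i\<close> and the apex of \<open>w\<close>.
  The condition \<open>0 \<le> s \<le> r < 1\<close> describes this triangle without the side
  opposite \<open>v\<close>.\<close>

definition sector_point :: "'a \<Rightarrow> 'a \<Rightarrow> 'b \<Rightarrow> real \<Rightarrow> real \<Rightarrow> ('a \<Rightarrow> real) \<times> ('b \<Rightarrow> real)" where
  "sector_point v i w r s =
     (\<lambda>u. if u = v then 1 - r else if u = i then r - s else 0, \<lambda>w'. if w' = w then s else 0)"

lemma open_star_region: "open star_region"
  unfolding star_region_def fan_coords_def Let_def prod.case by (intro open_Collect_less continuous_intros)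

lemma continuous_on_star_chart: "continuous_on A (star_chart a b c ab ac bc)"
proof -
  have *: "continuous_on A (\<lambda>p. fst p u)" "continuous_on A (\<lambda>p. snd p w)"
    for u w and A :: "(('a \<Rightarrow> real) \<times> ('b \<Rightarrow> real)) set"
    by (rule continuous_on_product_then_coordinatewise; intro continuous_intros)+
  show ?thesis
    unfolding star_chart_def[abs_def] Complex_eq by (intro continuous_intros *)
qed

lemma continuous_on_star_param: "continuous_on A (star_param v a b c ab ac bc)"
  unfolding star_param_def[abs_def] fan_coords_def Let_def prod.case
proof (intro continuous_on_Pair continuous_on_coordinatewise_then_product, goal_cases)
  case (1 i)
  then show ?case
    by (cases "i = v"; cases "i = a"; cases "i = b"; cases "i = c";
        simp only: if_True if_False refl; intro continuous_intros)
next
  case (2 i)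
  then show ?case
    by (cases "i = ab"; cases "i = ac"; cases "i = bc"; simp only: if_True if_False refl; intro continuous_intros)
qed

text \<open>A pair \<open>(i, w)\<close> stands for the triangle spanned by \<open>v\<close>, its neighbour \<open>i\<close> and the apex of the face \<open>w\<close>.\<close>

lemma star_distinct:
  assumes "distinct [v, a, b, c]" "distinct [ab, ac, bc]"
  shows "a \<noteq> v" "b \<noteq> v" "c \<noteq> v" "v \<noteq> a" "v \<noteq> b" "v \<noteq> c"
    "a \<noteq> b" "b \<noteq> a" "a \<noteq> c" "c \<noteq> a" "b \<noteq> c" "c \<noteq> b"
    "ab \<noteq> ac" "ac \<noteq> ab" "ab \<noteq> bc" "bc \<noteq> ab" "ac \<noteq> bc" "bc \<noteq> ac"
  using assms by auto

lemma star_param_sectors: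
  assumes "z \<in> star_region" and dist: "distinct [v, a, b, c]" "distinct [ab, ac, bc]"
  obtains i w r s where "(i, w) \<in> {(a, ab), (a, ac), (b, ab), (b, bc), (c, ac), (c, bc)}"
    "0 \<le> s" "s \<le> r" "r < 1" "star_param v a b c ab ac bc z = sector_point v i w r s"
proof -
  obtain pa pb pc where p: "fan_coords z = (pa, pb, pc)" by (metis prod_cases3)
  have p0: "0 \<le> pa" "0 \<le> pb" "0 \<le> pc" "pa = 0 \<or> pb = 0 \<or> pc = 0"
    using p by (auto simp: fan_coords_def Let_def min_def split: if_splits)
  have lt: "pa < 1" "pb < 1" "pc < 1" using assms(1) p by (auto simp: star_region_def)
  note defs = star_param_def sector_point_def p fun_eq_iff
  \<comment> \<open>One fan coordinate vanishes; comparing the other two cuts the plane into six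
    sectors, with \<open>r\<close> the larger and \<open>s\<close> the smaller of them.\<close>
  consider "pc = 0" "pb \<le> pa" | "pb = 0" "pc \<le> pa" | "pc = 0" "pa \<le> pb" | "pa = 0" "pc \<le> pb"
    | "pb = 0" "pa \<le> pc" | "pa = 0" "pb \<le> pc" using p0 by linarith
  then show thesis
  proof cases
    case 1 then show thesis using p0 lt by (intro that[of a ab pb pa]) (simp_all add: defs star_distinct[OF dist])
  next
    case 2 then show thesis using p0 lt by (intro that[of a ac pc pa]) (simp_all add: defs star_distinct[OF dist])
  next
    case 3 then show thesis using p0 lt by (intro that[of b ab pa pb]) (simp_all add: defs star_distinct[OF dist])
  next
    case 4 then show thesis using p0 lt by (intro that[of b bc pc pb]) (simp_all add: defs star_distinct[OF dist])
  next
    case 5 then show thesis using p0 lt by (intro that[of c ac pa pc]) (simp_all add: defs star_distinct[OF dist])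
  next
    case 6 then show thesis using p0 lt by (intro that[of c bc pb pc]) (simp_all add: defs star_distinct[OF dist])
  qed
qed

text \<open>The minima cancel in both components, leaving \<open>pa - pc\<close> and
  \<open>pb - pc\<close>, which are the real and imaginary parts of \<open>z\<close>.\<close>

lemma star_chart_param:
  assumes "distinct [v, a, b, c]" "distinct [ab, ac, bc]"
  shows "star_chart a b c ab ac bc (star_param v a b c ab ac bc z) = z"
proof -
  obtain pa pb pc where p: "fan_coords z = (pa, pb, pc)" by (metis prod_cases3)
  then have z: "Re z = pa - pc" "Im z = pb - pc"
    by (auto simp: fan_coords_def Let_def)
  have "star_chart a b c ab ac bc (star_param v a b c ab ac bc z) =
      Complex (pa - min pa pb - min pa pc - (pc - min pa pc - min pb pc) + min pa pb - min pb pc)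
        (pb - min pa pb - min pb pc - (pc - min pa pc - min pb pc) + min pa pb - min pa pc)"
    by (simp add: star_chart_def star_param_def p star_distinct[OF assms])
  also have "\<dots> = z" by (simp add: complex_eq_iff z)
  finally show ?thesis .
qed

lemma star_param_chart:
  assumes dist: "distinct [v, a, b, c]" "distinct [ab, ac, bc]"
    and iw: "(i, w) \<in> {(a, ab), (a, ac), (b, ab), (b, bc), (c, ac), (c, bc)}"
    and rs: "0 \<le> s" "s \<le> r" "r < 1"
  shows "star_chart a b c ab ac bc (sector_point v i w r s) \<in> star_region \<and>
    star_param v a b c ab ac bc (star_chart a b c ab ac bc (sector_point v i w r s)) = sector_point v i w r s"
proof -
  define z where "z = star_chart a b c ab ac bc (sector_point v i w r s)"
  \<comment> \<open>It is enough to know the fan coordinates of the image in each triangle: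
    \<open>r\<close> on the ray of \<open>i\<close>, \<open>s\<close> on the ray of the other
    neighbour at the face \<open>w\<close>, and 0 on the third ray.\<close>
  have *: "z \<in> star_region \<and> star_param v a b c ab ac bc z = sector_point v i w r s"
    if "fan_coords z = (pa, pb, pc)"
      "((i, w), pa, pb, pc) \<in> {((a, ab), r, s, 0), ((a, ac), r, 0, s), ((b, ab), s, r, 0),
        ((b, bc), 0, r, s), ((c, ac), s, 0, r), ((c, bc), 0, s, r)}" for pa pb pc
    using that(2) rs unfolding star_region_def star_param_def sector_point_def mem_Collect_eq that(1) prod.case
    by (elim insertE emptyE; simp add: fun_eq_iff star_distinct[OF dist])
  have z: "z = Complex (fst (sector_point v i w r s) a - fst (sector_point v i w r s) c +
         snd (sector_point v i w r s) ab - snd (sector_point v i w r s) bc)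
      (fst (sector_point v i w r s) b - fst (sector_point v i w r s) c +
         snd (sector_point v i w r s) ab - snd (sector_point v i w r s) ac)"
    by (simp add: z_def star_chart_def)
  note simps = sector_point_def fan_coords_def Let_def
  from iw consider "i = a" "w = ab" | "i = a" "w = ac" | "i = b" "w = ab" | "i = b" "w = bc"
    | "i = c" "w = ac" | "i = c" "w = bc" by auto
  then have "z \<in> star_region \<and> star_param v a b c ab ac bc z = sector_point v i w r s"
  proof cases
    case 1
    have "z = Complex r s" by (simp add: z simps 1 star_distinct[OF dist])
    with rs have "fan_coords z = (r, s, 0)" by (simp add: simps)
    then show ?thesis by (rule *) (simp add: 1)
  next
    case 2
    have "z = Complex (r - s) (- s)" by (simp add: z simps 2 star_distinct[OF dist])
    with rs have "fan_coords z = (r, 0, s)" by (simp add: simps)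
    then show ?thesis by (rule *) (simp add: 2)
  next
    case 3
    have "z = Complex s r" by (simp add: z simps 3 star_distinct[OF dist])
    with rs have "fan_coords z = (s, r, 0)" by (simp add: simps)
    then show ?thesis by (rule *) (simp add: 3)
  next
    case 4
    have "z = Complex (- s) (r - s)" by (simp add: z simps 4 star_distinct[OF dist])
    with rs have "fan_coords z = (0, r, s)" by (simp add: simps)
    then show ?thesis by (rule *) (simp add: 4)
  next
    case 5
    have "z = Complex (s - r) (- r)" by (simp add: z simps 5 star_distinct[OF dist])
    with rs have "fan_coords z = (s, 0, r)" by (simp add: simps)
    then show ?thesis by (rule *) (simp add: 5)
  next
    case 6
    have "z = Complex (- r) (s - r)" by (simp add: z simps 6 star_distinct[OF dist])
    with rs have "fan_coords z = (0, s, r)" by (simp add: simps)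
    then show ?thesis by (rule *) (simp add: 6)
  qed
  then show ?thesis by (simp add: z_def)
qed


section \<open>Charts and connectedness of the cone space\<close>

context cubic_face_system
begin

lemma continuous_on_coordinate:
  "continuous_on A (\<lambda>p. fst p u)" "continuous_on A (\<lambda>p. snd p w)"
  for A :: "(('a \<Rightarrow> real) \<times> ('a list \<Rightarrow> real)) set"
  by (rule continuous_on_product_then_coordinatewise; intro continuous_intros)+

lemma openin_coordinate_pos:
  "openin (top_of_set (cone_space T)) {p \<in> cone_space T. 0 < fst p v}"
  "openin (top_of_set (cone_space T)) {p \<in> cone_space T. 0 < snd p w}"
  using continuous_openin_preimage_gen[OF continuous_on_coordinate(1)[of "cone_space T" v], of "{0<..}"]
    continuous_openin_preimage_gen[OF continuous_on_coordinate(2)[of "cone_space T" w], of "{0<..}"]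
  by (simp_all add: vimage_def Int_def)

lemma face_two_edges:
  assumes "w \<in> T" "{v, a} \<in> set (walk_edges w)"
  obtains b where "b \<noteq> a" "{y. {v, y} \<in> set (walk_edges w)} = {a, b}"
  using cycle.two_edges_at_vertex[OF is_cycle[OF assms(1)] assms(2)] by metis

lemma sector_point_in_cone_space:
  assumes w: "w \<in> T" "{v, i} \<in> set (walk_edges w)" and rs: "0 \<le> s" "s \<le> r" "r < 1"
  shows "sector_point v i w r s \<in> {p \<in> cone_space T. 0 < fst p v}"
proof -
  \<comment> \<open>The line from the apex through the point meets the edge from \<open>v\<close> to
    \<open>i\<close> at parameter \<open>t\<close>; this exhibits the point as a cone point over the
    edge.\<close>
  define t where "t = (r - s) / (1 - s)"
  have t: "0 \<le> t" "t \<le> 1" "(1 - s) * t = r - s"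
    using rs by (auto simp: t_def field_simps)
  have "v \<noteq> i" using edge_ends face_edges w by blast
  then have "sector_point v i w r s = (\<lambda>u. (1 - s) * edge_point v i t u, \<lambda>w'. if w' = w then s else 0)"
    using t(3) by (auto simp: sector_point_def edge_point_def vertex_point_def fun_eq_iff algebra_simps)
  moreover have "edge_point v i t \<in> graph_realization {} (set (walk_edges w))"
    using w t by (auto simp: graph_realization_def)
  ultimately have "sector_point v i w r s \<in> cone_space T"
    unfolding mem_cone_space using w rs by (intro exI[of _ w] exI[of _ "edge_point v i t"] exI[of _ s]) auto
  then show ?thesis using rs by (simp add: sector_point_def)
qed

text \<open>A positive coordinate at \<open>v\<close> excludes the apex and puts the base point on
  an edge at \<open>v\<close>. Orienting that edge away from \<open>v\<close> gives the triangle,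
  with \<open>s = h\<close> and \<open>r = h + (1 - h) * t\<close>.\<close>

lemma cone_space_sectors:
  assumes p: "p \<in> cone_space T" "0 < fst p v"
  obtains i w r s where "w \<in> T" "{v, i} \<in> set (walk_edges w)" "0 \<le> s" "s \<le> r" "r < 1"
    "p = sector_point v i w r s"
proof -
  obtain w x h where w: "w \<in> T" and x: "x \<in> graph_realization {} (set (walk_edges w))"
    and h: "0 \<le> h" "h \<le> 1" and p': "p = (\<lambda>u. (1 - h) * x u, \<lambda>w'. if w' = w then h else 0)"
    using p(1) unfolding mem_cone_space by blast
  have xv: "0 < (1 - h) * x v" using p(2) by (simp add: p')
  obtain a b t where ab: "x = edge_point a b t" "{a, b} \<in> set (walk_edges w)" "0 \<le> t" "t \<le> 1"
    using x by (auto simp: graph_realization_def)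
  have "v = a \<or> v = b" using xv by (auto simp: ab(1) edge_point_def vertex_point_def split: if_splits)
  then obtain i t where it: "{v, i} \<in> set (walk_edges w)" "x = edge_point v i t" "0 \<le> t" "t \<le> 1"
  proof
    assume "v = a"
    then show thesis using that[of b t] ab by simp
  next
    assume "v = b"
    then show thesis using that[of a "1 - t"] ab edge_point_swap[of a b t] by (simp add: insert_commute)
  qed
  have vi: "v \<noteq> i" using edge_ends face_edges w it(1) by blast
  have "h \<noteq> 1" using xv by auto
  have "x v = 1 - t" using vi by (simp add: it(2) edge_point_def vertex_point_def)
  with xv have "0 < (1 - h) * (1 - t)" by simp
  then have "h + (1 - h) * t < 1" by (simp add: algebra_simps)
  moreover have "p = sector_point v i w (h + (1 - h) * t) h"
    using vi by (auto simp: p' it(2) sector_point_def edge_point_def vertex_point_def fun_eq_iff algebra_simps)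
  moreover have "0 \<le> (1 - h) * t" using h it by simp
  ultimately show thesis using that[OF w it(1), of h "h + (1 - h) * t"] h by simp
qed

text \<open>The three corners at \<open>v\<close> are filled by three different faces and no other
  face meets \<open>v\<close>. The open star thus consists of six triangles arranged cyclically,
  which the chart unfolds onto the six sectors of the plane.\<close>

lemma vertex_chart:
  assumes v: "v \<in> V"
  shows "\<exists>W :: complex set. open W \<and>
    top_of_set {p \<in> cone_space T. 0 < fst p v} homeomorphic_space top_of_set W"
proof -
  obtain a b c where abc: "distinct [a, b, c]" "{y. {v, y} \<in> E} = {a, b, c}"
    using cubic[OF v] by blast
  then have e: "{v, a} \<in> E" "{v, b} \<in> E" "{v, c} \<in> E" by blast+
  then have d1: "distinct [v, a, b, c]" using abc(1) edge_ends by auto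
  obtain ab where ab: "ab \<in> T" "{v, a} \<in> set (walk_edges ab)" "{v, b} \<in> set (walk_edges ab)"
    using corner[OF e(1,2)] d1 by auto
  obtain ac where ac: "ac \<in> T" "{v, a} \<in> set (walk_edges ac)" "{v, c} \<in> set (walk_edges ac)"
    using corner[OF e(1,3)] d1 by auto
  obtain bc where bc: "bc \<in> T" "{v, b} \<in> set (walk_edges bc)" "{v, c} \<in> set (walk_edges bc)"
    using corner[OF e(2,3)] d1 by auto
  \<comment> \<open>A face uses only two edges at \<open>v\<close>; hence the faces of two different
    corners cannot coincide.\<close>
  have not3: False if t: "w \<in> T" "{v, a} \<in> set (walk_edges w)" "{v, b} \<in> set (walk_edges w)"
    "{v, c} \<in> set (walk_edges w)" for w
  proof -
    obtain y where "{y. {v, y} \<in> set (walk_edges w)} = {a, y}"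
      using face_two_edges[OF t(1,2)] by metis
    then have "b \<in> {a, y}" "c \<in> {a, y}" using t by blast+
    then show False using abc(1) by auto
  qed
  have d2: "distinct [ab, ac, bc]" using not3[of ab] not3[of ac] ab ac bc by auto
  let ?S = "{(a, ab), (a, ac), (b, ab), (b, bc), (c, ac), (c, bc)}"
  \<comment> \<open>The second edge of the face at \<open>v\<close> completes a corner, and
    uniqueness of the face there identifies \<open>w\<close> as \<open>ab\<close>, \<open>ac\<close>
    or \<open>bc\<close>.\<close>
  have sector: "(i, w) \<in> ?S" if w: "w \<in> T" "{v, i} \<in> set (walk_edges w)" for i w
  proof -
    obtain j where j: "j \<noteq> i" "{y. {v, y} \<in> set (walk_edges w)} = {i, j}"
      using face_two_edges[OF w] by metis
    then have wj: "{v, j} \<in> set (walk_edges w)" by blast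
    have E: "{v, i} \<in> E" "{v, j} \<in> E" using w wj face_edges by blast+
    then have ij: "i \<in> {a, b, c}" "j \<in> {a, b, c}" using abc(2) by blast+
    have u: "w = w'" if "w' \<in> T" "{v, i} \<in> set (walk_edges w')" "{v, j} \<in> set (walk_edges w')" for w'
      using corner[OF E] j(1) w wj that by metis
    consider "i = a" "j = b" | "i = a" "j = c" | "i = b" "j = a" | "i = b" "j = c" | "i = c" "j = a"
      | "i = c" "j = b" using ij j(1) by blast
    then show ?thesis by cases (use u[of ab] u[of ac] u[of bc] ab ac bc in simp_all)
  qed
  have S: "w \<in> T \<and> {v, i} \<in> set (walk_edges w)" if "(i, w) \<in> ?S" for i w
    using that by (elim insertE emptyE) (use ab ac bc in simp_all)
  have "top_of_set {p \<in> cone_space T. 0 < fst p v} homeomorphic_space top_of_set star_region"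
  proof (rule homeomorphic_space_setI[OF continuous_on_star_chart[of _ a b c ab ac bc]
        continuous_on_star_param[of _ v a b c ab ac bc]])
    fix p assume "p \<in> {p \<in> cone_space T. 0 < fst p v}"
    then have p: "p \<in> cone_space T" "0 < fst p v" by auto
    obtain i w r s where "w \<in> T" "{v, i} \<in> set (walk_edges w)" and rs: "0 \<le> s" "s \<le> r" "r < 1"
      and ps: "p = sector_point v i w r s" using cone_space_sectors[OF p] .
    then have "(i, w) \<in> ?S" by (intro sector)
    from star_param_chart[OF d1 d2 this rs] show "star_chart a b c ab ac bc p \<in> star_region \<and>
        star_param v a b c ab ac bc (star_chart a b c ab ac bc p) = p"
      unfolding ps .
  next
    fix z assume "z \<in> star_region"
    from star_param_sectors[OF this d1 d2]
    obtain i w r s where iw: "(i, w) \<in> ?S" and rs: "0 \<le> s" "s \<le> r" "r < 1"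
      and ps: "star_param v a b c ab ac bc z = sector_point v i w r s" .
    have "star_param v a b c ab ac bc z \<in> {p \<in> cone_space T. 0 < fst p v}"
      unfolding ps using S[OF iw] rs by (intro sector_point_in_cone_space) auto
    then show "star_param v a b c ab ac bc z \<in> {p \<in> cone_space T. 0 < fst p v} \<and>
        star_chart a b c ab ac bc (star_param v a b c ab ac bc z) = z"
      using star_chart_param[OF d1 d2] by blast
  qed
  then show ?thesis using open_star_region by blast
qed

text \<open>The cone parametrisation is a homeomorphism from the compact closed disk onto its image;
  positive height at \<open>w\<close> singles out the image of the open disk.\<close>

lemma face_chart:
  assumes w: "w \<in> T"
  shows "top_of_set {p \<in> cone_space T. 0 < snd p w} homeomorphic_space top_of_set (ball (0 :: complex) 1)"
proof -
  interpret cycle w using is_cycle[OF w] .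
  have "homeomorphic_map (top_of_set (cball 0 1)) (top_of_set (cone_point w ` cball 0 1)) (cone_point w)"
  proof (rule continuous_imp_homeomorphic_map)
    show "continuous_map (top_of_set (cball 0 1)) (top_of_set (cone_point w ` cball 0 1)) (cone_point w)"
      using continuous_on_cone_point by (auto simp: continuous_map_in_subtopology)
    show "compact_space (top_of_set (cball 0 1 :: complex set))"
      by (simp add: compact_space_subtopology)
    show "Hausdorff_space (top_of_set (cone_point w ` cball 0 1))"
      by (rule Hausdorff_space_subtopology[OF Hausdorff_space_coordinates])
    show "inj_on (cone_point w) (topspace (top_of_set (cball 0 1)))"
      by (auto intro!: inj_onI cone_point_inj)
  qed auto
  then have "homeomorphic_map (subtopology (top_of_set (cball 0 1)) (ball 0 1))
      (subtopology (top_of_set (cone_point w ` cball 0 1)) (cone_point w ` ball 0 1)) (cone_point w)"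
    by (rule homeomorphic_map_subtopologies) (auto simp: less_imp_le)
  moreover have "cone_point w ` ball 0 1 = {p \<in> cone_space T. 0 < snd p w}"
  proof (intro equalityI subsetI)
    fix p assume "p \<in> cone_point w ` ball 0 1"
    then obtain z where "norm z < 1" "p = cone_point w z" by auto
    moreover then have "0 < snd p w" by (simp add: cone_point_def)
    ultimately show "p \<in> {p \<in> cone_space T. 0 < snd p w}"
      using w by (auto simp: cone_space_def intro!: bexI[of _ w])
  next
    fix p assume "p \<in> {p \<in> cone_space T. 0 < snd p w}"
    then obtain w' z where "p = cone_point w' z" "norm z \<le> 1" "0 < snd (cone_point w' z) w"
      by (auto simp: cone_space_def)
    then show "p \<in> cone_point w ` ball 0 1"
      by (auto simp: cone_point_def[of w'] split: if_splits)
  qed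
  moreover have "subtopology (top_of_set (cball 0 1)) (ball 0 1) = top_of_set (ball (0 :: complex) 1)"
    by (simp add: subtopology_subtopology Int_absorb1 ball_subset_cball)
  moreover have "subtopology (top_of_set (cone_point w ` cball 0 1)) (cone_point w ` ball 0 1) =
      top_of_set (cone_point w ` ball 0 1)"
    unfolding subtopology_subtopology
    by (rule arg_cong[of _ _ "subtopology euclidean"]) (use ball_subset_cball in blast)
  ultimately show ?thesis
    using homeomorphic_map_imp_homeomorphic_space homeomorphic_space_sym by metis
qed

text \<open>Each closed disk is connected and contains the ends of its boundary edges. Every edge
  lies on a disk, so paths in the graph link all vertices, and each point is linked to a vertex of
  its own disk.\<close>

lemma connected_cone_space: "connected (cone_space T)"
proof -
  let ?c = "connected_component (cone_space T)"
  define pt :: "'a \<Rightarrow> ('a \<Rightarrow> real) \<times> ('a list \<Rightarrow> real)" where "pt v = (vertex_point v, \<lambda>_. 0)" for v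
  have face: "?c p q" if "w \<in> T" "p \<in> cone_point w ` cball 0 1" "q \<in> cone_point w ` cball 0 1" for w p q
  proof -
    have "connected (cone_point w ` cball 0 1)"
      by (intro connected_continuous_image cycle.continuous_on_cone_point is_cycle that) auto
    then show ?thesis
      unfolding connected_component_def using that by (auto simp: cone_space_def)
  qed
  have on_face: "pt v \<in> cone_point w ` cball 0 1" if "w \<in> T" "{v, y} \<in> set (walk_edges w)" for v y w
  proof -
    have "edge_point v y 0 \<in> graph_realization {} (set (walk_edges w))"
      using that(2) by (fastforce simp: graph_realization_def simp del: edge_point_0)
    then show ?thesis
      unfolding cycle.cone_point_image[OF is_cycle[OF that(1)]] pt_def
      by (intro CollectI exI[of _ "vertex_point v"] exI[of _ 0]) auto
  qed
  have edge: "?c (pt u) (pt v)" if e: "{u, v} \<in> E" for u v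
  proof -
    obtain w where w: "w \<in> T" "{u, v} \<in> set (walk_edges w)" using edge_on_face[OF e] .
    then have "{v, u} \<in> set (walk_edges w)" by (simp add: insert_commute)
    then show ?thesis using face[OF w(1) on_face[OF w] on_face[OF w(1)]] by blast
  qed
  have vertices: "?c (pt u) (pt v)" if uv: "u \<in> V" "v \<in> V" for u v
  proof -
    have "(u, v) \<in> {(x, y). {x, y} \<in> E}\<^sup>*"
      using conn uv by (auto simp: connected_graph_def)
    then show ?thesis
    proof induction
      case base
      \<comment> \<open>Reflexivity requires the vertex to lie in the space; going to a neighbour
        and back provides this.\<close>
      obtain y where "{u, y} \<in> E" using cubic[OF uv(1)] by blast
      from edge[OF this] show ?case
        using connected_component_trans connected_component_sym by blast
    next
      case (step y z)
      then have "?c (pt y) (pt z)" by (intro edge) simp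
      with step.IH show ?case by (rule connected_component_trans)
    qed
  qed
  have point: "\<exists>v\<in>V. ?c p (pt v)" if p: "p \<in> cone_space T" for p
  proof -
    obtain w where w: "w \<in> T" "p \<in> cone_point w ` cball 0 1" using p by (auto simp: cone_space_def)
    have "hd w \<in> set w" using cycle.w_nonempty[OF is_cycle[OF w(1)]] by simp
    moreover then obtain y where "{hd w, y} \<in> set (walk_edges w)"
      using cycle.vertex_on_edge[OF is_cycle[OF w(1)]] by metis
    ultimately show ?thesis using face[OF w(1) w(2) on_face[OF w(1)]] face_vertices[OF w(1)] by blast
  qed
  show ?thesis
    unfolding connected_iff_connected_component
  proof (intro ballI)
    fix p q assume "p \<in> cone_space T" "q \<in> cone_space T"
    then obtain u v where "u \<in> V" "v \<in> V" "?c p (pt u)" "?c q (pt v)" using point by blast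
    then show "?c p q"
      using vertices[of u v] connected_component_trans connected_component_sym by blast
  qed
qed

lemma closed_surface_X: "closed_surface (map_space V E T)"
proof (rule closed_surface_homeomorphic[OF cone_coords_homeomorphic])
  have comp: "compact_space (top_of_set (cone_space T))"
    using cone_coords_homeomorphic compact_space_X homeomorphic_compact_space
      homeomorphic_map_imp_homeomorphic_space by blast
  have chart: "\<exists>U. openin (top_of_set (cone_space T)) U \<and> p \<in> U \<and>
      (\<exists>W :: complex set. open W \<and> subtopology (top_of_set (cone_space T)) U homeomorphic_space top_of_set W)"
    if p: "p \<in> cone_space T" for p
  proof -
    have sub: "subtopology (top_of_set (cone_space T)) {p \<in> cone_space T. Q p} =
        top_of_set {p \<in> cone_space T. Q p}" for Q
      unfolding subtopology_subtopology by (rule arg_cong[of _ _ "subtopology euclidean"]) blast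
    obtain w x h where w: "w \<in> T" and x: "x \<in> graph_realization {} (set (walk_edges w))"
      and h: "0 \<le> h" "h \<le> 1" and p': "p = (\<lambda>u. (1 - h) * x u, \<lambda>w'. if w' = w then h else 0)"
      using p unfolding mem_cone_space by blast
    show ?thesis
    proof (cases "h = 0")
      case True
      obtain a b t where ab: "x = edge_point a b t" "{a, b} \<in> set (walk_edges w)" "0 \<le> t" "t \<le> 1"
        using x by (auto simp: graph_realization_def)
      have abV: "a \<in> V" "b \<in> V" using ab(2) face_edges[OF w] edge_ends by blast+
      \<comment> \<open>The coordinates at the ends are \<open>1 - t\<close> and \<open>t\<close>,
        so one is positive and the point lies in the star of that end.\<close>
      have "0 < x a \<or> 0 < x b" using ab by (auto simp: edge_point_def vertex_point_def)
      then obtain v where v: "v \<in> V" "0 < fst p v" using abV by (auto simp: p' True)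
      then have "p \<in> {p \<in> cone_space T. 0 < fst p v}" using p by blast
      with openin_coordinate_pos(1)[of v] vertex_chart[OF v(1)] show ?thesis
        by (intro exI[of _ "{p \<in> cone_space T. 0 < fst p v}"]) (simp add: sub)
    next
      case False
      then have "p \<in> {p \<in> cone_space T. 0 < snd p w}" using p h by (simp add: p')
      with openin_coordinate_pos(2)[of w] face_chart[OF w] show ?thesis
        by (intro exI[of _ "{p \<in> cone_space T. 0 < snd p w}"] conjI) (auto simp: sub)
    qed
  qed
  have conn: "connected_space (top_of_set (cone_space T))"
    using connected_cone_space by (simp add: connected_space_subtopology)
  show "closed_surface (top_of_set (cone_space T))"
    using comp conn chart Hausdorff_space_subtopology[OF Hausdorff_space_coordinates]
    by (simp add: closed_surface_def)
qed

lemma is_map: "is_map V E T"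
  using simple conn closed_surface_X closed_walk_T cycle.distinct_walk_edges[OF is_cycle]
  by (simp add: is_map_def simple_closed_walk_def)

end


section \<open>Extending graph automorphisms\<close>

text \<open>A graph automorphism is constrained only on the vertex set. Extending by the identity
  gives a permutation of the whole type, with a total inverse for reindexing coordinates.\<close>

lemma bij_extend_id:
  assumes "bij_betw f A A"
  shows "bij (\<lambda>x. if x \<in> A then f x else x)"
proof -
  let ?f = "\<lambda>x. if x \<in> A then f x else x"
  have "bij_betw ?f A A" using assms by (simp cong: bij_betw_cong)
  moreover have "bij_betw ?f (- A) (- A)" by (auto simp: bij_betw_def inj_on_def image_iff)
  ultimately have "bij_betw ?f (A \<union> - A) (A \<union> - A)" by (rule bij_betw_combine) simp
  then show ?thesis by simp
qed

lemma image_eq_of_bij_betw: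
  assumes "bij_betw h X X" "A \<subseteq> X" "B \<subseteq> X" "\<And>p. p \<in> X \<Longrightarrow> h p \<in> B \<longleftrightarrow> p \<in> A"
  shows "h ` A = B"
proof -
  have "b \<in> h ` A" if "b \<in> B" for b
  proof -
    have "b \<in> h ` X" using assms(1,3) that by (auto simp: bij_betw_def)
    then show ?thesis using assms(4) that by auto
  qed
  then show ?thesis using assms(2,4) by auto
qed

context cubic_face_system
begin

lemma finite_E: "finite E"
  using simple finite_subset[of E "Pow V"] by (auto simp: simple_graph_def)

lemma finite_flags: "finite (flags E T)"
proof (rule finite_subset)
  show "flags E T \<subseteq> V \<times> E \<times> T"
    using simple by (auto simp: flags_def simple_graph_def)
  show "finite (V \<times> E \<times> T)"
    using simple finite_E finite_T by (simp add: simple_graph_def)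
qed

text \<open>This and the analogous test for open faces describe cells by heights alone, so their
  images can be computed in coordinates.\<close>

lemma graph_points_iff:
  assumes "p \<in> map_points V E T"
  shows "p \<in> Inl ` graph_realization V E \<longleftrightarrow> (\<forall>w. snd (cone_coords p) w = 0)"
proof -
  have "\<exists>w. snd (cone_point w' z) w \<noteq> 0" if "norm z < 1" for w' :: "'a list" and z
    using that by (auto simp: cone_point_def)
  then show ?thesis using assms by (fastforce simp: map_points_def)
qed

lemma open_face_iff:
  assumes "p \<in> map_points V E T" "w \<in> T"
  shows "p \<in> open_face w \<longleftrightarrow> snd (cone_coords p) w > 0"
  using assms by (auto simp: map_points_def open_face_def cone_point_def split: if_splits)

text \<open>Vertex coordinates are permuted by \<alpha> and heights by \<sigma>. The agreement of
  \<sigma> with \<alpha> on edge sets makes this preserve the cone space; conjugating by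
  \<open>cone_coords\<close> gives the required homeomorphism.\<close>

lemma automorphism_extends:
  assumes \<alpha>: "graph_automorphism V E \<alpha>" and \<sigma>: "bij_betw \<sigma> T T"
    and edges: "\<And>w. w \<in> T \<Longrightarrow> set (walk_edges (\<sigma> w)) = (`) \<alpha> ` set (walk_edges w)"
  shows "\<exists>\<phi>. map_automorphism V E T \<phi> \<and> flag_map_extends E T \<phi> \<alpha>"
proof -
  let ?X = "map_points V E T"
  define f where "f = (\<lambda>v. if v \<in> V then \<alpha> v else v)"
  define s where "s = (\<lambda>w. if w \<in> T then \<sigma> w else w)"
  have f: "bij f" and s: "bij s"
    unfolding f_def s_def using \<alpha> \<sigma> by (auto simp: graph_automorphism_def intro!: bij_extend_id)
  have EV: "e \<subseteq> V" if "e \<in> E" for e using simple that by (simp add: simple_graph_def)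
  have fV: "f ` V = V" using \<alpha> by (simp add: f_def graph_automorphism_def bij_betw_def cong: image_cong)
  have f_edge: "f ` e = \<alpha> ` e" if "e \<in> E" for e
    using EV[OF that] by (auto simp: f_def intro!: image_cong)
  have fE: "f ` e \<in> E" if e: "e \<in> E" for e
  proof -
    have "card e = 2" using simple e by (simp add: simple_graph_def)
    then obtain u v where "e = {u, v}" by (auto simp: card_2_iff)
    then show ?thesis using \<alpha> EV[OF e] e by (simp add: f_def graph_automorphism_def)
  qed
  have sT: "s w \<in> T" "s w = \<sigma> w" if "w \<in> T" for w
    using that \<sigma> by (auto simp: s_def bij_betw_def)
  have sedges: "set (walk_edges (s w)) = (`) f ` set (walk_edges w)" if w: "w \<in> T" for w
    using edges[OF w] face_edges[OF w] f_edge sT(2)[OF w] by (auto simp: image_iff subset_iff)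

  \<comment> \<open>Composing with the inverses moves the coordinate at \<open>v\<close> to
    \<open>f v\<close> and the height at \<open>w\<close> to \<open>s w\<close>; \<open>Q\<close>
    undoes this.\<close>
  define P :: "('a \<Rightarrow> real) \<times> ('a list \<Rightarrow> real) \<Rightarrow> ('a \<Rightarrow> real) \<times> ('a list \<Rightarrow> real)"
    where "P p = (fst p \<circ> inv f, snd p \<circ> inv s)" for p
  define Q :: "('a \<Rightarrow> real) \<times> ('a list \<Rightarrow> real) \<Rightarrow> ('a \<Rightarrow> real) \<times> ('a list \<Rightarrow> real)"
    where "Q p = (fst p \<circ> f, snd p \<circ> s)" for p
  have inv_s: "inv s w' = w \<longleftrightarrow> w' = s w" for w w' using s by (metis bij_inv_eq_iff)
  have s_eq: "s w = s w' \<longleftrightarrow> w = w'" for w w' using s by (simp add: bij_is_inj inj_eq)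
  have P_cone: "P p \<in> cone_space T" if p: "p \<in> cone_space T" for p
  proof -
    obtain w x h where w: "w \<in> T" and x: "x \<in> graph_realization {} (set (walk_edges w))"
      and h: "0 \<le> h" "h \<le> 1" and p': "p = (\<lambda>u. (1 - h) * x u, \<lambda>w'. if w' = w then h else 0)"
      using p unfolding mem_cone_space by blast
    obtain a b t where ab: "x = edge_point a b t" "{a, b} \<in> set (walk_edges w)" "0 \<le> t" "t \<le> 1"
      using x by (auto simp: graph_realization_def)
    have "f ` {a, b} \<in> set (walk_edges (s w))" using ab(2) by (simp only: sedges[OF w] imageI)
    then have "x \<circ> inv f \<in> graph_realization {} (set (walk_edges (s w)))"
      using ab by (auto simp: edge_point_comp_inv[OF f] graph_realization_def)
    moreover have "P p = (\<lambda>u. (1 - h) * (x \<circ> inv f) u, \<lambda>w'. if w' = s w then h else 0)"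
      by (auto simp: P_def p' inv_s fun_eq_iff)
    ultimately show ?thesis unfolding mem_cone_space using sT(1)[OF w] h by blast
  qed
  have Q_cone: "Q p \<in> cone_space T" if p: "p \<in> cone_space T" for p
  proof -
    obtain w' x h where w': "w' \<in> T" and x: "x \<in> graph_realization {} (set (walk_edges w'))"
      and h: "0 \<le> h" "h \<le> 1" and p': "p = (\<lambda>u. (1 - h) * x u, \<lambda>w''. if w'' = w' then h else 0)"
      using p unfolding mem_cone_space by blast
    have "w' \<in> \<sigma> ` T" using w' \<sigma> by (simp add: bij_betw_def)
    then obtain w where w: "w \<in> T" "w' = s w" using sT(2) by auto
    obtain a b t where ab: "x = edge_point a b t" "{a, b} \<in> set (walk_edges w')" "0 \<le> t" "t \<le> 1"
      using x by (auto simp: graph_realization_def)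
    obtain e where e: "e \<in> set (walk_edges w)" "{a, b} = f ` e"
      using ab(2) by (auto simp: w sedges[OF w(1)])
    have "inv f ` {a, b} = e" unfolding e(2) by (simp add: image_comp bij_is_inj[OF f])
    then have "{inv f a, inv f b} \<in> set (walk_edges w)" using e(1) by simp
    moreover have "x \<circ> f = edge_point (inv f a) (inv f b) t"
      using edge_point_comp_inv[OF bij_imp_bij_inv[OF f], of a b t] by (simp add: ab(1) inv_inv_eq[OF f])
    ultimately have "x \<circ> f \<in> graph_realization {} (set (walk_edges w))"
      using ab by (auto simp: graph_realization_def)
    moreover have "Q p = (\<lambda>u. (1 - h) * (x \<circ> f) u, \<lambda>w'. if w' = w then h else 0)"
      by (auto simp: Q_def p' w s_eq fun_eq_iff)
    ultimately show ?thesis unfolding mem_cone_space using w(1) h by blast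
  qed
  have cont: "continuous_on (cone_space T) (\<lambda>p. (fst p \<circ> j, snd p \<circ> k))" for j :: "'a \<Rightarrow> 'a" and k :: "'a list \<Rightarrow> 'a list"
    unfolding comp_def
    by (intro continuous_on_Pair continuous_on_coordinatewise_then_product continuous_on_coordinate)
  have "P (Q p) = p" "Q (P p) = p" for p
    using f s by (simp_all add: P_def Q_def prod_eq_iff fun_eq_iff bij_is_inj surj_f_inv_f bij_is_surj)
  then have "homeomorphic_maps (top_of_set (cone_space T)) (top_of_set (cone_space T)) P Q"
    unfolding homeomorphic_maps_def
    using P_cone Q_cone cont[of "inv f" "inv s"] cont[of f s]
    by (auto simp: continuous_map_in_subtopology P_def[abs_def] Q_def[abs_def])
  then have P: "homeomorphic_map (top_of_set (cone_space T)) (top_of_set (cone_space T)) P"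
    using homeomorphic_maps_imp_map by blast
  obtain \<Psi> where \<Psi>: "homeomorphic_maps (map_space V E T) (top_of_set (cone_space T)) cone_coords \<Psi>"
    using cone_coords_homeomorphic homeomorphic_map_maps by blast
  have \<Psi>_map: "homeomorphic_map (top_of_set (cone_space T)) (map_space V E T) \<Psi>"
    using \<Psi> homeomorphic_maps_sym homeomorphic_maps_imp_map by blast
  define h where "h = \<Psi> \<circ> (P \<circ> cone_coords)"
  have h: "homeomorphic_map (map_space V E T) (map_space V E T) h"
    unfolding h_def
    by (intro homeomorphic_map_compose[OF _ \<Psi>_map] homeomorphic_map_compose[OF cone_coords_homeomorphic P])
  have bij_h: "bij_betw h ?X ?X"
    using homeomorphic_imp_injective_map[OF h] homeomorphic_imp_surjective_map[OF h]
    by (simp add: topspace_X bij_betw_def)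
  have hX: "h p \<in> ?X" if "p \<in> ?X" for p
    using bij_h that by (auto simp: bij_betw_def)
  have coords_h: "cone_coords (h p) = P (cone_coords p)" if p: "p \<in> ?X" for p
  proof -
    have "P (cone_coords p) \<in> cone_space T"
      using p cone_coords_image by (intro P_cone) blast
    then show ?thesis using \<Psi> by (simp add: h_def homeomorphic_maps_def)
  qed
  have h_Inl: "h (Inl x) = Inl (x \<circ> inv f)"
    if "x \<in> graph_realization V E" "x \<circ> inv f \<in> graph_realization V E" for x
  proof -
    have X: "Inl x \<in> ?X" "Inl (x \<circ> inv f) \<in> ?X" using that by (auto simp: map_points_def)
    have "cone_coords (h (Inl x)) = cone_coords (Inl (x \<circ> inv f))"
      using coords_h[OF X(1)] by (simp add: P_def comp_def)
    then show ?thesis using inj_onD[OF inj_cone_coords _ hX[OF X(1)] X(2)] by blast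
  qed
  have h_vertex: "h (Inl (vertex_point v)) = Inl (vertex_point (f v))" if v: "v \<in> V" for v
  proof -
    have "vertex_point v \<circ> inv f = vertex_point (f v)"
      using edge_point_comp_inv[OF f, of v v 0] by simp
    moreover have "vertex_point v \<in> graph_realization V E" "vertex_point (f v) \<in> graph_realization V E"
      using v fV by (auto simp: graph_realization_def)
    ultimately show ?thesis using h_Inl[of "vertex_point v"] by simp
  qed
  have h_edge_point: "h (Inl (edge_point u v t)) = Inl (edge_point (f u) (f v) t)"
    if "{u, v} \<in> E" "0 \<le> t" "t \<le> 1" for u v t
  proof -
    have "{f u, f v} \<in> E" using fE[OF that(1)] by simp
    then have "edge_point u v t \<in> graph_realization V E" "edge_point (f u) (f v) t \<in> graph_realization V E"
      using that by (auto simp: graph_realization_def)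
    then show ?thesis using h_Inl[of "edge_point u v t"] by (simp add: edge_point_comp_inv[OF f])
  qed
  have h_graph: "h ` (Inl ` graph_realization V E) = Inl ` graph_realization V E"
  proof (rule image_eq_of_bij_betw[OF bij_h])
    fix p assume p: "p \<in> ?X"
    have "(\<forall>w. snd (P q) w = 0) \<longleftrightarrow> (\<forall>w. snd q w = 0)" for q
      unfolding P_def snd_conv comp_def by (metis inv_f_f[OF bij_is_inj[OF s]])
    then show "h p \<in> Inl ` graph_realization V E \<longleftrightarrow> p \<in> Inl ` graph_realization V E"
      using p hX[OF p] by (simp add: graph_points_iff coords_h)
  qed (auto simp: map_points_def)
  have h_face: "h ` open_face w = open_face (s w)" if w: "w \<in> T" for w
  proof (rule image_eq_of_bij_betw[OF bij_h])
    show "open_face w \<subseteq> ?X" "open_face (s w) \<subseteq> ?X"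
      using w sT(1) by (auto simp: open_face_def map_points_def)
    fix p assume p: "p \<in> ?X"
    show "h p \<in> open_face (s w) \<longleftrightarrow> p \<in> open_face w"
      using p hX[OF p] w sT(1)[OF w] by (simp add: open_face_iff coords_h P_def bij_is_inj[OF s])
  qed
  have h_edge: "h ` open_edge e = open_edge (f ` e)" if e: "e \<in> E" for e
  proof
    show "h ` open_edge e \<subseteq> open_edge (f ` e)"
    proof
      fix q assume "q \<in> h ` open_edge e"
      then obtain u v t where uv: "{u, v} = e" "0 < t" "t < 1" "q = h (Inl (edge_point u v t))"
        by (auto simp: open_edge_def)
      then have "q = Inl (edge_point (f u) (f v) t)" using h_edge_point[of u v t] e by simp
      then show "q \<in> open_edge (f ` e)" using uv unfolding open_edge_def by blast
    qed
    show "open_edge (f ` e) \<subseteq> h ` open_edge e"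
    proof
      fix q assume "q \<in> open_edge (f ` e)"
      then obtain u v t where uv: "{u, v} = f ` e" "0 < t" "t < 1" "q = Inl (edge_point u v t)"
        by (auto simp: open_edge_def)
      have "{inv f u, inv f v} = inv f ` f ` e" using uv(1) by (metis image_empty image_insert)
      then have e': "{inv f u, inv f v} = e" by (simp add: image_comp bij_is_inj[OF f])
      then have "h (Inl (edge_point (inv f u) (inv f v) t)) = q"
        using h_edge_point[of "inv f u" "inv f v" t] e uv by (simp add: bij_inv_eq_iff surj_f_inv_f bij_is_surj[OF f])
      then show "q \<in> h ` open_edge e" using e' uv(2,3) unfolding open_edge_def by blast
    qed
  qed

  define \<phi> where "\<phi> = (\<lambda>(v, e, w). (f v, f ` e, s w))"
  have "\<phi> ` flags E T \<subseteq> flags E T"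
    using fE sT(1) sedges by (auto simp: \<phi>_def flags_def)
  moreover have "inj \<phi>"
  proof (rule injI)
    fix x y assume "\<phi> x = \<phi> y"
    then show "x = y"
      by (cases x; cases y)
        (simp add: \<phi>_def inj_eq[OF bij_is_inj[OF f]] inj_eq[OF bij_is_inj[OF s]] inj_image_eq_iff[OF bij_is_inj[OF f]])
  qed
  \<comment> \<open>There are finitely many flags, so an injective map of flags into flags is a
    permutation.\<close>
  then have "inj_on \<phi> (flags E T)" by (rule inj_on_subset) simp
  ultimately have "bij_betw \<phi> (flags E T) (flags E T)"
    using endo_inj_surj[OF finite_flags] by (simp add: bij_betw_def)
  moreover have "preserves_graph V E h"
  proof -
    have "h ` (Inl ` vertex_point ` V) = (\<lambda>v. Inl (vertex_point (f v))) ` V"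
      by (simp add: image_image h_vertex cong: image_cong)
    also have "\<dots> = Inl ` vertex_point ` f ` V" by (simp add: image_image)
    finally show ?thesis using h_graph by (simp add: preserves_graph_def fV)
  qed
  moreover have "h (Inl (vertex_point v)) = Inl (vertex_point v') \<and> h ` open_edge e = open_edge e' \<and>
      h ` open_face w = open_face w'"
    if "(v, e, w) \<in> flags E T" "\<phi> (v, e, w) = (v', e', w')" for v e w v' e' w'
  proof -
    have "v \<in> V" "e \<in> E" "w \<in> T" using that(1) EV by (auto simp: flags_def)
    then show ?thesis using that(2) h_vertex h_edge h_face by (auto simp: \<phi>_def)
  qed
  then have "\<forall>(v, e, w) \<in> flags E T. \<forall>v' e' w'. \<phi> (v, e, w) = (v', e', w') \<longrightarrow>
      h (Inl (vertex_point v)) = Inl (vertex_point v') \<and> h ` open_edge e = open_edge e' \<and>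
      h ` open_face w = open_face w'"
    by (intro ballI) (simp only: split_paired_all prod.case, blast)
  ultimately have "map_automorphism V E T \<phi>"
    unfolding map_automorphism_def using h by (intro conjI exI[of _ h])
  moreover have "flag_map_extends E T \<phi> \<alpha>"
    using EV f_edge by (auto simp: flag_map_extends_def flags_def \<phi>_def f_def)
  ultimately show ?thesis by blast
qed

end


section \<open>Girth cycles of a cubic graph with signature (2, 2, 2)\<close>

lemma walk_edges_map: "walk_edges (map f w) = map ((`) f) (walk_edges w)"
proof -
  have "map f w ! (Suc i mod length w) = f (w ! (Suc i mod length w))" if "i < length w" for i
    using that by (intro nth_map mod_less_divisor) auto
  then show ?thesis by (auto simp: walk_edges_def)
qed

lemma girth_cycle_walks:
  assumes "C \<in> girth_cycles E"
  obtains w where "cycle_walk E w" "enat (length w) = girth E" "set (walk_edges w) = C"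
  using assms by (auto simp: girth_cycles_def)

lemma set_subset_vertices:
  assumes "simple_graph V E" "cycle_walk E w"
  shows "set w \<subseteq> V"
proof -
  interpret cycle w using assms(2) by (simp add: cycle_def cycle_walk_def)
  have "set (walk_edges w) \<subseteq> E" using assms(2) by (simp add: cycle_walk_def closed_walk_def)
  then show ?thesis
    using assms(1) vertex_on_edge by (auto simp: simple_graph_def) (metis insertI1 subsetD)
qed

text \<open>Mapping a walk through \<alpha> preserves its length, its edges stay in
  \<open>E\<close>, and injectivity on \<open>V\<close> keeps its vertices distinct.\<close>

lemma girth_cycle_image:
  assumes simple: "simple_graph V E" and \<alpha>: "graph_automorphism V E \<alpha>" and C: "C \<in> girth_cycles E"
  shows "(`) \<alpha> ` C \<in> girth_cycles E"
proof -
  obtain w where w: "cycle_walk E w" "enat (length w) = girth E" "set (walk_edges w) = C"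
    using girth_cycle_walks[OF C] .
  have wV: "set w \<subseteq> V" using set_subset_vertices[OF simple w(1)] .
  have "inj_on \<alpha> (set w)" using \<alpha> wV by (meson bij_betw_def graph_automorphism_def inj_on_subset)
  moreover have "\<alpha> ` e \<in> E" if e: "e \<in> E" for e
  proof -
    have "card e = 2" "e \<subseteq> V" using simple e by (auto simp: simple_graph_def)
    then obtain u v where "e = {u, v}" by (auto simp: card_2_iff)
    then show ?thesis using \<alpha> \<open>e \<subseteq> V\<close> e by (simp add: graph_automorphism_def)
  qed
  ultimately have "cycle_walk E (map \<alpha> w)"
    using w(1) by (auto simp: cycle_walk_def closed_walk_def walk_edges_map distinct_map)
  then have "set (walk_edges (map \<alpha> w)) \<in> girth_cycles E"
    unfolding girth_cycles_def using w(2) by (auto intro!: exI[of _ "map \<alpha> w"])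
  then show ?thesis by (simp add: walk_edges_map w(3))
qed

lemma signature_edge_count:
  assumes "vertex_signature E v = [2, 2, 2]" "finite E" "e \<in> E" "v \<in> e"
  shows "edge_girth_count E e = 2"
proof -
  have "mset (vertex_signature E v) = image_mset (edge_girth_count E) (mset_set (incident_edges E v))"
    by (simp add: vertex_signature_def)
  then have "image_mset (edge_girth_count E) (mset_set (incident_edges E v)) = {#2, 2, 2#}"
    by (simp add: assms(1))
  from arg_cong[OF this, of set_mset] have "edge_girth_count E ` incident_edges E v = {2}"
    using assms(2) by (simp add: incident_edges_def)
  then show ?thesis using assms(3,4) by (auto simp: incident_edges_def)
qed

text \<open>Each set is the disjoint union of its intersections with the other two. The three
  intersection sizes therefore have pairwise sums 2, so all of them are 1.\<close>

lemma card_pairwise_Int_eq_1: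
  assumes "finite A" "finite B" "finite C" "card A = 2" "card B = 2" "card C = 2"
    and "A \<subseteq> B \<union> C" "B \<subseteq> A \<union> C" "C \<subseteq> A \<union> B" "A \<inter> B \<inter> C = {}"
  shows "card (A \<inter> B) = 1"
proof -
  have split: "card X = card (X \<inter> Y) + card (X \<inter> Z)"
    if "finite X" "X \<subseteq> Y \<union> Z" "X \<inter> Y \<inter> Z = {}" for X Y Z :: "'a set"
  proof -
    have "X = (X \<inter> Y) \<union> (X \<inter> Z)" using that(2) by blast
    moreover have "card ((X \<inter> Y) \<union> (X \<inter> Z)) = card (X \<inter> Y) + card (X \<inter> Z)"
      using that by (intro card_Un_disjoint) auto
    ultimately show ?thesis by simp
  qed
  have "card A = card (A \<inter> B) + card (A \<inter> C)" using assms by (intro split) auto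
  moreover have "card B = card (B \<inter> A) + card (B \<inter> C)" using assms by (intro split) auto
  moreover have "card C = card (C \<inter> A) + card (C \<inter> B)" using assms by (intro split) auto
  ultimately show ?thesis using assms by (simp add: Int_commute)
qed

theorem theorem3p11:
  fixes V :: "'a set" and E :: "'a set set" and g n :: nat
  assumes "simple_graph V E"
    and "connected_graph V E"
    and "regular_graph V E 3"
    and "girth_regular V E"
    and "girth E = enat g"
    and "card V = n"
    and "has_signature V E [2, 2, 2]"
  shows "g dvd 3 * n \<and>
    (\<exists>T. mk_map g 3 V E T \<and>
       real_of_int (euler_char V E T) = real n * (3 / real g - 1 / 2) \<and>
       (\<forall>\<alpha>. graph_automorphism V E \<alpha> \<longrightarrow>
          (\<exists>\<phi>. map_automorphism V E T \<phi> \<and> flag_map_extends E T \<phi> \<alpha>)) \<and>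
       (vertex_transitive_graph V E \<longrightarrow> vertex_transitive_map V E T))"
proof -
  note simple = assms(1) and conn = assms(2)
  have finV: "finite V" and EV: "\<And>e. e \<in> E \<Longrightarrow> e \<subseteq> V" and E2: "\<And>e. e \<in> E \<Longrightarrow> card e = 2"
    using simple by (auto simp: simple_graph_def)
  have finE: "finite E" using finV EV finite_subset[of E "Pow V"] by auto
  have ends: "u \<in> V" "v \<in> V" "u \<noteq> v" if "{u, v} \<in> E" for u v
    using EV[OF that] E2[OF that] by auto

  \<comment> \<open>Girth cycles are edge sets while faces are walks; one root and one orientation
    are chosen per cycle, so that no disk is attached twice.\<close>
  define walk where "walk C = (SOME w. cycle_walk E w \<and> enat (length w) = girth E \<and> set (walk_edges w) = C)" for C
  have walk: "cycle_walk E (walk C) \<and> enat (length (walk C)) = girth E \<and> set (walk_edges (walk C)) = C"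
    if "C \<in> girth_cycles E" for C
    unfolding walk_def by (rule someI_ex) (use girth_cycle_walks[OF that] in blast)
  define T where "T = walk ` girth_cycles E"
  have T: "cycle_walk E w" "length w = g" "set (walk_edges w) \<in> girth_cycles E" if "w \<in> T" for w
    using that walk assms(5) by (auto simp: T_def)
  have cyc: "cycle w" if "w \<in> T" for w
    using T(1)[OF that] by (simp add: cycle_def cycle_walk_def)
  have T_edges: "set (walk_edges w) \<subseteq> E" if "w \<in> T" for w
    using T(1)[OF that] by (simp add: cycle_walk_def closed_walk_def)
  have bijT: "bij_betw (\<lambda>w. set (walk_edges w)) T (girth_cycles E)"
    unfolding T_def by (rule bij_betw_byWitness[of _ walk]) (use walk in auto)
  have "girth_cycles E \<subseteq> Pow E"
    by (auto simp: girth_cycles_def cycle_walk_def closed_walk_def)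
  then have "finite (girth_cycles E)" using finE finite_subset by blast
  then have finT: "finite T" by (simp add: T_def)

  \<comment> \<open>Each corner lies on exactly one face\<close>
  define F where "F e = {w \<in> T. e \<in> set (walk_edges w)}" for e
  have cardF: "card (F e) = 2" if e: "e \<in> E" for e
  proof -
    have "e \<noteq> {}" using E2[OF e] by auto
    then obtain v where v: "v \<in> e" "v \<in> V" using EV[OF e] by blast
    have "bij_betw (\<lambda>w. set (walk_edges w)) (F e) {C \<in> girth_cycles E. e \<in> C}"
    proof (rule bij_betw_subset[OF bijT])
      have "girth_cycles E = (\<lambda>w. set (walk_edges w)) ` T" using bijT by (simp add: bij_betw_def)
      then show "(\<lambda>w. set (walk_edges w)) ` F e = {C \<in> girth_cycles E. e \<in> C}"
        by (auto simp: F_def)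
    qed (auto simp: F_def)
    then have "card (F e) = edge_girth_count E e"
      unfolding edge_girth_count_def by (rule bij_betw_same_card)
    also have "\<dots> = 2"
      using signature_edge_count[OF _ finE e v(1)] assms(7) v(2) by (simp add: has_signature_def)
    finally show ?thesis .
  qed
  have finF: "finite (F e)" for e using finT by (simp add: F_def)

  have nbrs: "bij_betw (\<lambda>y. {v, y}) {y. {v, y} \<in> E} (incident_edges E v)" for v
  proof -
    have "\<exists>y. e = {v, y}" if e: "e \<in> E" "v \<in> e" for e
    proof -
      obtain a b where "e = {a, b}" using E2[OF e(1)] by (auto simp: card_2_iff)
      then show ?thesis using e(2) by auto
    qed
    then show ?thesis
      by (auto simp: bij_betw_def incident_edges_def inj_on_def doubleton_eq_iff image_iff)
  qed
  have cubic: "\<exists>a b c. distinct [a, b, c] \<and> {y. {v, y} \<in> E} = {a, b, c}" if "v \<in> V" for v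
  proof -
    have "card {y. {v, y} \<in> E} = 3"
      using bij_betw_same_card[OF nbrs] assms(3) that by (simp add: regular_graph_def)
    then show ?thesis by (auto simp: card_3_iff)
  qed
  have corner: "\<exists>!w. w \<in> T \<and> {v, a} \<in> set (walk_edges w) \<and> {v, b} \<in> set (walk_edges w)"
    if va: "{v, a} \<in> E" and vb: "{v, b} \<in> E" and "a \<noteq> b" for v a b
  proof -
    obtain c where c: "c \<noteq> a" "c \<noteq> b" "{y. {v, y} \<in> E} = {a, b, c}"
    proof -
      obtain x y z where xyz: "distinct [x, y, z]" "{y. {v, y} \<in> E} = {x, y, z}"
        using cubic[OF ends(1)[OF va]] by metis
      then have "a \<in> {x, y, z}" "b \<in> {x, y, z}" using va vb by blast+
      then show thesis using that[of x] that[of y] that[of z] xyz \<open>a \<noteq> b\<close> by auto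
    qed
    then have vc: "{v, c} \<in> E" by blast
    have two: "\<exists>y. y \<noteq> i \<and> {y. {v, y} \<in> set (walk_edges w)} = {i, y} \<and> y \<in> {a, b, c}" if "w \<in> F {v, i}" for w i
    proof -
      have w: "w \<in> T" "{v, i} \<in> set (walk_edges w)" using that by (auto simp: F_def)
      obtain y where y: "y \<noteq> i" "{y. {v, y} \<in> set (walk_edges w)} = {i, y}"
        using cycle.two_edges_at_vertex[OF cyc[OF w(1)] w(2)] by metis
      then have "{v, y} \<in> E" using T_edges[OF w(1)] by blast
      then show ?thesis using y c(3) by blast
    qed
    \<comment> \<open>The sets of faces at the three edges have two elements each. A face through
      \<open>v\<close> lies in exactly two of them, since it uses exactly two edges at
      \<open>v\<close>.\<close>
    have "card (F {v, a} \<inter> F {v, b}) = 1"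
    proof (rule card_pairwise_Int_eq_1[of _ _ "F {v, c}"])
      have other: "w \<in> F {v, j} \<union> F {v, k}" if wi: "w \<in> F {v, i}" "{a, b, c} \<subseteq> {i, j, k}" for w i j k
      proof -
        obtain y where y: "y \<noteq> i" "{y. {v, y} \<in> set (walk_edges w)} = {i, y}" "y \<in> {a, b, c}"
          using two[OF wi(1)] by blast
        then have "{v, y} \<in> set (walk_edges w)" "y = j \<or> y = k" using wi(2) by blast+
        then show ?thesis using wi(1) by (auto simp: F_def)
      qed
      show "F {v, a} \<subseteq> F {v, b} \<union> F {v, c}" using other[of _ a b c] by blast
      show "F {v, b} \<subseteq> F {v, a} \<union> F {v, c}" using other[of _ b a c] by blast
      show "F {v, c} \<subseteq> F {v, a} \<union> F {v, b}" using other[of _ c a b] by blast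
      show "F {v, a} \<inter> F {v, b} \<inter> F {v, c} = {}"
      proof (rule ccontr)
        assume "\<not> ?thesis"
        then obtain w where w: "w \<in> F {v, a}" "w \<in> F {v, b}" "w \<in> F {v, c}" by blast
        obtain y where "{y. {v, y} \<in> set (walk_edges w)} = {a, y}" using two[OF w(1)] by blast
        then have "b \<in> {a, y}" "c \<in> {a, y}" using w by (auto simp: F_def)
        then show False using c \<open>a \<noteq> b\<close> by auto
      qed
    qed (use cardF finF va vb vc in auto)
    then obtain w where w: "F {v, a} \<inter> F {v, b} = {w}" by (auto simp: card_1_singleton_iff)
    have "w' \<in> T \<and> {v, a} \<in> set (walk_edges w') \<and> {v, b} \<in> set (walk_edges w') \<longleftrightarrow> w' = w" for w'
      using w unfolding F_def by blast
    then show ?thesis by simp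
  qed
  interpret cubic_face_system V E T
    by unfold_locales (use simple conn finT T(1) cubic corner in auto)

  \<comment> \<open>Incidence counts and the Euler characteristic\<close>
  have gT: "g * card T = 2 * card E"
  proof -
    have "(\<Sum>e\<in>E. card (F e)) = (\<Sum>w\<in>T. card {e \<in> E. e \<in> set (walk_edges w)})"
      unfolding F_def by (rule sum_multicount_gen[OF finE finT]) simp
    moreover have "card {e \<in> E. e \<in> set (walk_edges w)} = g" if "w \<in> T" for w
    proof -
      have "{e \<in> E. e \<in> set (walk_edges w)} = set (walk_edges w)" using T_edges[OF that] by blast
      then show ?thesis using cycle.card_walk_edges[OF cyc[OF that]] T(2)[OF that] by simp
    qed
    ultimately show ?thesis using cardF by (simp add: mult.commute)
  qed
  have nE: "3 * n = 2 * card E"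
  proof -
    have "(\<Sum>v\<in>V. card {e \<in> E. v \<in> e}) = (\<Sum>e\<in>E. card {v \<in> V. v \<in> e})"
      by (rule sum_multicount_gen[OF finV finE]) simp
    moreover have "card {v \<in> V. v \<in> e} = 2" if "e \<in> E" for e
    proof -
      have "{v \<in> V. v \<in> e} = e" using EV[OF that] by blast
      then show ?thesis using E2[OF that] by simp
    qed
    moreover have "card {e \<in> E. v \<in> e} = 3" if "v \<in> V" for v
      using assms(3) that by (simp add: regular_graph_def incident_edges_def)
    ultimately show ?thesis using assms(6) by (simp add: mult.commute)
  qed
  have "n > 0" using conn finV assms(6) by (auto simp: connected_graph_def card_gt_0_iff)
  \<comment> \<open>If \<open>g\<close> were 0, the two counts would give \<open>3 * n = 0\<close>.
    Positivity permits the division by \<open>g\<close> in the Euler characteristic, where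
    \<open>card E = 3n/2\<close> and \<open>card T = 3n/g\<close>.\<close>
  with gT nE have g: "g > 0" by (metis mult_is_0 neq0_conv zero_neq_numeral)
  have "real g * real (card T) = 3 * real n" "3 * real n = 2 * real (card E)"
    using gT nE by (metis of_nat_mult of_nat_numeral)+
  then have euler: "real_of_int (euler_char V E T) = real n * (3 / real g - 1 / 2)"
    using g assms(6) by (simp add: euler_char_def field_simps)
  have map: "mk_map g 3 V E T"
    using is_map assms(3) T(2) by (simp add: mk_map_def)

  \<comment> \<open>Extension of graph automorphisms to the map\<close>
  have aut: "\<exists>\<phi>. map_automorphism V E T \<phi> \<and> flag_map_extends E T \<phi> \<alpha>"
    if \<alpha>: "graph_automorphism V E \<alpha>" for \<alpha>
  proof (rule automorphism_extends[OF \<alpha>])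
    \<comment> \<open>The chosen walk of the image cycle; it may differ from the image of
      \<open>w\<close> in root and orientation, so only edge sets are compared.\<close>
    define \<sigma> where "\<sigma> w = walk ((`) \<alpha> ` set (walk_edges w))" for w
    have im: "(`) \<alpha> ` set (walk_edges w) \<in> girth_cycles E" if "w \<in> T" for w
      using girth_cycle_image[OF simple \<alpha> T(3)[OF that]] .
    show \<sigma>_edges: "set (walk_edges (\<sigma> w)) = (`) \<alpha> ` set (walk_edges w)" if "w \<in> T" for w
      using walk[OF im[OF that]] by (simp add: \<sigma>_def)
    have "\<sigma> ` T \<subseteq> T" using im by (auto simp: \<sigma>_def T_def)
    moreover have "inj_on \<sigma> T"
    proof (rule inj_onI)
      fix w w' assume w: "w \<in> T" "w' \<in> T" "\<sigma> w = \<sigma> w'"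
      have "inj_on ((`) \<alpha>) (Pow V)"
        using \<alpha> by (intro inj_on_image_Pow) (simp add: graph_automorphism_def bij_betw_def)
      moreover have "set (walk_edges w) \<subseteq> Pow V" "set (walk_edges w') \<subseteq> Pow V"
        using T_edges w(1,2) EV by blast+
      moreover have "(`) \<alpha> ` set (walk_edges w) = (`) \<alpha> ` set (walk_edges w')"
        using \<sigma>_edges w by metis
      ultimately have "set (walk_edges w) = set (walk_edges w')"
        using inj_on_image_eq_iff[of "(`) \<alpha>" "Pow V" "set (walk_edges w)" "set (walk_edges w')"] by simp
      then show "w = w'" using bijT w(1,2) by (auto simp: bij_betw_def inj_on_def)
    qed
    ultimately show "bij_betw \<sigma> T T"
      using endo_inj_surj[OF finT] by (simp add: bij_betw_def)
  qed
  have "vertex_transitive_map V E T" if "vertex_transitive_graph V E"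
    using that aut unfolding vertex_transitive_graph_def vertex_transitive_map_def by metis
  moreover have "g dvd 3 * n" using gT nE by (metis dvd_triv_left)
  ultimately show ?thesis using map euler aut by blast
qed

end
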